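(* If the eddy viscosity satisfies $\nu_T<4\nu$, then the BDF2 post-processed VMS-POD approximation (Steps 1 and 2 in the context) is stable in the following sense: $$ \begin{aligned} &\|\mathbf u_r^{M+1}\|^2+\|2\mathbf u_r^{M+1}-\mathbf u_r^M\|^2+2\nu_T\Delta t\Big\|(I-P_R)\nabla\frac{\mathbf w_r^{M+1}+\mathbf u_r^{M+1}}2\Big\|^2+2\nu\Delta t\|\nabla\mathbf w_r^{M+1}\|^2\\ &\quad+\sum_{n=1}^M\|\mathbf w_r^{n+1}-2\mathbf u_r^n+\mathbf u_r^{n-1}\|^2+(4\nu-\nu_T)\frac{\Delta t}2\sum_{n=1}^{M-1}\|\nabla\mathbf w_r^{n+1}\|^2\\ &\le\|\mathbf u_r^1\|^2+\|2\mathbf u_r^1-\mathbf u_r^0\|^2+\frac{\nu_T\Delta t}2\|\nabla\mathbf u_r^1\|^2+2\nu^{-1}|||\mathbf f|||_{2,-1}^2 . \end{aligned} $$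
   Context: $\Omega\subset\mathbb R^{\ell}$, $\ell\in\{2,3\}$, is a polygonal/polyhedral domain; $\|\cdot\|$, $(\cdot,\cdot)$ are the $L^2(\Omega)$ norm and inner product (for scalar, vector or matrix fields), $\mathbf X=(H_0^1(\Omega))^{\ell}$, and $\|\mathbf f\|_{-1}=\sup_{\mathbf v\in\mathbf X}|(\mathbf f,\mathbf v)|/\|\nabla\mathbf v\|$. $\nu>0$ is the kinematic viscosity, $\mathbf f\in L^2(0,T;H^{-1}(\Omega))$ the forcing (pointwise values $\mathbf f^n=\mathbf f(t^n)$, $t^n=n\Delta t$, are assumed meaningful), $\Delta t>0$ the time step, and here $|||\mathbf f|||_{2,-1}=\big(\Delta t\sum_{n=0}^{M+1}\|\mathbf f^n\|_{-1}^2\big)^{1/2}$. The skew-symmetric convective form is $b(\mathbf u,\mathbf v,\mathbf w)=\frac12\big(((\mathbf u\cdot\nabla)\mathbf v,\mathbf w)-((\mathbf u\cdot\nabla)\mathbf w,\mathbf v)\big)$. POD spaces: $\boldsymbol\psi_1,\dots,\boldsymbol\psi_r\in\mathbf X$ are $L^2$-orthonormal POD basis functions (obtained from finite element snapshots of a Navier-Stokes solution lying in a conforming finite element space $\mathbf X^h\subset\mathbf X$), $R<r$, $\mathbf X^r=\mathrm{span}\{\boldsymbol\psi_1,\dots,\boldsymbol\psi_r\}$, $\mathbf L^R=\mathrm{span}\{\nabla\boldsymbol\psi_1,\dots,\nabla\boldsymbol\psi_R\}$, and $P_R$ is the $L^2$-orthogonal projection onto $\mathbf L^R$. $\nu_T>0$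 is a given constant (eddy viscosity). BDF2 algorithm: initial data $\mathbf u_r^0,\mathbf u_r^{-1}\in\mathbf X^r$ are given. For $n=0,1,2,\dots$: Step 1: find $\mathbf w_r^{n+1}\in\mathbf X^r$ with $\big(\frac{3\mathbf w_r^{n+1}-4\mathbf u_r^n+\mathbf u_r^{n-1}}{2\Delta t},\boldsymbol\psi\big)+b(\mathbf w_r^{n+1},\mathbf w_r^{n+1},\boldsymbol\psi)+\nu(\nabla\mathbf w_r^{n+1},\nabla\boldsymbol\psi)=(\mathbf f^{n+1},\boldsymbol\psi)$ for all $\boldsymbol\psi\in\mathbf X^r$. Step 2: find $\mathbf u_r^{n+1}\in\mathbf X^r$ with $\big(\frac{\mathbf w_r^{n+1}-\mathbf u_r^{n+1}}{\Delta t},\boldsymbol\psi\big)=\big(\nu_T(I-P_R)\nabla\frac{\mathbf w_r^{n+1}+\mathbf u_r^{n+1}}2,(I-P_R)\nabla\boldsymbol\psi\big)$ for all $\boldsymbol\psi\in\mathbf X^r$. $M\ge1$ is an integer. *)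

theory Defs
  imports "HOL-Analysis.Analysis"
begin

text \<open>
  Elements of \<open>L\<^sup>2(\<Omega>)\<close> are represented by functions on the whole space; only their values on
  \<open>\<Omega>\<close>, up to null sets, enter the inner product and the norm.
  The dimension of space is \<open>CARD('n)\<close>.
\<close>


subsection \<open>Polygonal and polyhedral domains\<close>

definition polyhedral_domain :: "(real ^ 'n) set \<Rightarrow> bool" where
  "polyhedral_domain \<Omega> \<longleftrightarrow>
     open \<Omega> \<and> connected \<Omega> \<and> bounded \<Omega> \<and> \<Omega> \<noteq> {} \<and>
     (\<exists>\<F>. finite \<F> \<and> (\<forall>S\<in>\<F>. polytope S \<and> aff_dim S = int CARD('n) - 1) \<and>
           frontier \<Omega> = \<Union>\<F>)"


subsection \<open>The space \<open>L\<^sup>2(\<Omega>)\<close> for scalar, vector and matrix fields\<close>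

definition L2 :: "(real ^ 'n) set \<Rightarrow> (real ^ 'n \<Rightarrow> 'b::euclidean_space) set" where
  "L2 \<Omega> = {f \<in> borel_measurable (lebesgue_on \<Omega>).
            integrable (lebesgue_on \<Omega>) (\<lambda>x. (norm (f x))\<^sup>2)}"

text \<open>On matrices of type \<open>real ^ 'n ^ 'n\<close> the product \<open>\<bullet>\<close> is the Frobenius product.\<close>

definition l2_inner ::
  "(real ^ 'n) set \<Rightarrow> (real ^ 'n \<Rightarrow> 'b::euclidean_space) \<Rightarrow> (real ^ 'n \<Rightarrow> 'b) \<Rightarrow> real" where
  "l2_inner \<Omega> f g = (LINT x|lebesgue_on \<Omega>. f x \<bullet> g x)"

definition l2_norm :: "(real ^ 'n) set \<Rightarrow> (real ^ 'n \<Rightarrow> 'b::euclidean_space) \<Rightarrow> real" where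
  "l2_norm \<Omega> f = sqrt (l2_inner \<Omega> f f)"


subsection \<open>Test functions, weak gradients and \<open>H\<^sub>0\<^sup>1(\<Omega>)\<close>\<close>

definition partial_deriv :: "'n \<Rightarrow> (real ^ 'n \<Rightarrow> real) \<Rightarrow> real ^ 'n \<Rightarrow> real" where
  "partial_deriv i \<phi> x = frechet_derivative \<phi> (at x) (axis i 1)"

fun C_k :: "nat \<Rightarrow> (real ^ 'n \<Rightarrow> real) \<Rightarrow> bool" where
  "C_k 0 \<phi> \<longleftrightarrow> continuous_on UNIV \<phi>"
| "C_k (Suc k) \<phi> \<longleftrightarrow> (\<forall>x. \<phi> differentiable (at x)) \<and> (\<forall>i. C_k k (partial_deriv i \<phi>))"

definition test_functions :: "(real ^ 'n) set \<Rightarrow> (real ^ 'n \<Rightarrow> real) set" where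
  "test_functions \<Omega> =
     {\<phi>. (\<forall>k. C_k k \<phi>) \<and> (\<exists>K. compact K \<and> K \<subseteq> \<Omega> \<and> (\<forall>x. x \<notin> K \<longrightarrow> \<phi> x = 0))}"

definition has_weak_gradient ::
  "(real ^ 'n) set \<Rightarrow> (real ^ 'n \<Rightarrow> real) \<Rightarrow> (real ^ 'n \<Rightarrow> real ^ 'n) \<Rightarrow> bool" where
  "has_weak_gradient \<Omega> v g \<longleftrightarrow>
     g \<in> L2 \<Omega> \<and>
     (\<forall>\<phi>\<in>test_functions \<Omega>. \<forall>i.
        l2_inner \<Omega> v (partial_deriv i \<phi>) = - l2_inner \<Omega> (\<lambda>x. g x $ i) \<phi>)"

definition H1 :: "(real ^ 'n) set \<Rightarrow> (real ^ 'n \<Rightarrow> real) set" where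
  "H1 \<Omega> = {v \<in> L2 \<Omega>. \<exists>g. has_weak_gradient \<Omega> v g}"

text \<open>A weak gradient is unique almost everywhere in \<open>\<Omega>\<close>; one representative is chosen.\<close>

definition weak_grad :: "(real ^ 'n) set \<Rightarrow> (real ^ 'n \<Rightarrow> real) \<Rightarrow> real ^ 'n \<Rightarrow> real ^ 'n" where
  "weak_grad \<Omega> v = (SOME g. has_weak_gradient \<Omega> v g)"

definition h1_norm :: "(real ^ 'n) set \<Rightarrow> (real ^ 'n \<Rightarrow> real) \<Rightarrow> real" where
  "h1_norm \<Omega> v = sqrt ((l2_norm \<Omega> v)\<^sup>2 + (l2_norm \<Omega> (weak_grad \<Omega> v))\<^sup>2)"

text \<open>The closure of the test functions in \<open>H\<^sup>1(\<Omega>)\<close>.\<close>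

definition H10 :: "(real ^ 'n) set \<Rightarrow> (real ^ 'n \<Rightarrow> real) set" where
  "H10 \<Omega> = {v \<in> H1 \<Omega>. \<forall>\<epsilon>>0. \<exists>\<phi>\<in>test_functions \<Omega>. h1_norm \<Omega> (\<lambda>x. v x - \<phi> x) < \<epsilon>}"


subsection \<open>Velocity fields\<close>

type_synonym 'n vfield = "real ^ 'n \<Rightarrow> real ^ 'n"

definition X_space :: "(real ^ 'n) set \<Rightarrow> 'n vfield set" where
  "X_space \<Omega> = {v. \<forall>i. (\<lambda>x. v x $ i) \<in> H10 \<Omega>}"

text \<open>The entry of \<open>\<nabla>v\<close> in row \<open>i\<close> and column \<open>j\<close> is \<open>\<partial>\<^sub>j v\<^sub>i\<close>.\<close>

definition grad :: "(real ^ 'n) set \<Rightarrow> 'n vfield \<Rightarrow> real ^ 'n \<Rightarrow> real ^ 'n ^ 'n" where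
  "grad \<Omega> v x = (\<chi> i. weak_grad \<Omega> (\<lambda>y. v y $ i) x)"

definition convect :: "(real ^ 'n) set \<Rightarrow> 'n vfield \<Rightarrow> 'n vfield \<Rightarrow> 'n vfield" where
  "convect \<Omega> u v x = grad \<Omega> v x *v u x"

definition b_form :: "(real ^ 'n) set \<Rightarrow> 'n vfield \<Rightarrow> 'n vfield \<Rightarrow> 'n vfield \<Rightarrow> real" where
  "b_form \<Omega> u v w =
     (1/2) * (l2_inner \<Omega> (convect \<Omega> u v) w - l2_inner \<Omega> (convect \<Omega> u w) v)"


subsection \<open>\<open>H\<^sup>-\<^sup>1(\<Omega>)\<close> and the forcing\<close>

text \<open>
  The dual of \<open>X\<close>, normed by \<open>\<parallel>\<nabla>v\<parallel>\<close>; \<open>F v\<close> stands for the pairing \<open>(F, v)\<close>.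
  Boundedness forces \<open>F\<close> to agree on fields that coincide almost everywhere.
\<close>

definition Hm1 :: "(real ^ 'n) set \<Rightarrow> ('n vfield \<Rightarrow> real) set" where
  "Hm1 \<Omega> = {F.
     (\<forall>u\<in>X_space \<Omega>. \<forall>v\<in>X_space \<Omega>. \<forall>a b.
        F (\<lambda>x. a *\<^sub>R u x + b *\<^sub>R v x) = a * F u + b * F v) \<and>
     (\<exists>C. \<forall>v\<in>X_space \<Omega>. \<bar>F v\<bar> \<le> C * l2_norm \<Omega> (grad \<Omega> v))}"

text \<open>For \<open>v = 0\<close> the quotient is \<open>0 / 0 = 0\<close>, which does not affect the supremum.\<close>

definition Hm1_norm :: "(real ^ 'n) set \<Rightarrow> ('n vfield \<Rightarrow> real) \<Rightarrow> real" where
  "Hm1_norm \<Omega> F = (SUP v\<in>X_space \<Omega>. \<bar>F v\<bar> / l2_norm \<Omega> (grad \<Omega> v))"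

text \<open>
  \<open>L\<^sup>2(0,T;H\<^sup>-\<^sup>1(\<Omega>))\<close>, with a representative whose point values on \<open>[0,T]\<close> are all defined.
  Strong measurability is the same as weak measurability here, \<open>H\<^sup>-\<^sup>1(\<Omega>)\<close> being a separable
  Hilbert space.
\<close>

definition L2_time_Hm1 :: "real \<Rightarrow> (real ^ 'n) set \<Rightarrow> (real \<Rightarrow> 'n vfield \<Rightarrow> real) set" where
  "L2_time_Hm1 T \<Omega> = {f.
     (\<forall>t\<in>{0..T}. f t \<in> Hm1 \<Omega>) \<and>
     (\<forall>v\<in>X_space \<Omega>. (\<lambda>t. f t v) \<in> borel_measurable (lebesgue_on {0..T})) \<and>
     integrable (lebesgue_on {0..T}) (\<lambda>t. (Hm1_norm \<Omega> (f t))\<^sup>2)}"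

definition norm_2_m1 ::
  "(real ^ 'n) set \<Rightarrow> real \<Rightarrow> int \<Rightarrow> (real \<Rightarrow> 'n vfield \<Rightarrow> real) \<Rightarrow> real" where
  "norm_2_m1 \<Omega> \<Delta>t M f =
     sqrt (\<Delta>t * (\<Sum>n=0..M+1. (Hm1_norm \<Omega> (f (of_int n * \<Delta>t)))\<^sup>2))"


subsection \<open>POD spaces\<close>

definition orthonormal_fields :: "(real ^ 'n) set \<Rightarrow> nat \<Rightarrow> (nat \<Rightarrow> 'n vfield) \<Rightarrow> bool" where
  "orthonormal_fields \<Omega> r \<psi> \<longleftrightarrow>
     (\<forall>i\<in>{1..r}. \<forall>j\<in>{1..r}. l2_inner \<Omega> (\<psi> i) (\<psi> j) = (if i = j then 1 else 0))"

definition Xr :: "nat \<Rightarrow> (nat \<Rightarrow> 'n::finite vfield) \<Rightarrow> 'n vfield set" where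
  "Xr r \<psi> = {v. \<exists>c :: nat \<Rightarrow> real. v = (\<lambda>x. \<Sum>i=1..r. c i *\<^sub>R \<psi> i x)}"

definition LR ::
  "(real ^ 'n) set \<Rightarrow> nat \<Rightarrow> (nat \<Rightarrow> 'n vfield) \<Rightarrow> (real ^ 'n \<Rightarrow> real ^ 'n ^ 'n) set" where
  "LR \<Omega> R \<psi> = {G. \<exists>c :: nat \<Rightarrow> real. G = (\<lambda>x. \<Sum>i=1..R. c i *\<^sub>R grad \<Omega> (\<psi> i) x)}"

definition l2_proj ::
  "(real ^ 'n) set \<Rightarrow> (real ^ 'n \<Rightarrow> 'b::euclidean_space) set \<Rightarrow>
     (real ^ 'n \<Rightarrow> 'b) \<Rightarrow> real ^ 'n \<Rightarrow> 'b" where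
  "l2_proj \<Omega> L G = (SOME P. P \<in> L \<and> (\<forall>H\<in>L. l2_inner \<Omega> (\<lambda>x. G x - P x) H = 0))"

text \<open>\<open>(I - P\<^sub>R) \<nabla>v\<close>\<close>

definition fluct_grad ::
  "(real ^ 'n) set \<Rightarrow> nat \<Rightarrow> (nat \<Rightarrow> 'n vfield) \<Rightarrow> 'n vfield \<Rightarrow> real ^ 'n \<Rightarrow> real ^ 'n ^ 'n" where
  "fluct_grad \<Omega> R \<psi> v x = grad \<Omega> v x - l2_proj \<Omega> (LR \<Omega> R \<psi>) (grad \<Omega> v) x"


subsection \<open>One time step of the BDF2 post-processed VMS-POD scheme\<close>

definition bdf2_step1 ::
  "(real ^ 'n) set \<Rightarrow> nat \<Rightarrow> (nat \<Rightarrow> 'n vfield) \<Rightarrow> real \<Rightarrow> real \<Rightarrow> ('n vfield \<Rightarrow> real) \<Rightarrow>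
     'n vfield \<Rightarrow> 'n vfield \<Rightarrow> 'n vfield \<Rightarrow> bool" where
  "bdf2_step1 \<Omega> r \<psi> \<nu> \<Delta>t F u_prev u w_next \<longleftrightarrow>
     w_next \<in> Xr r \<psi> \<and>
     (\<forall>\<theta>\<in>Xr r \<psi>.
        l2_inner \<Omega> (\<lambda>x. (1 / (2 * \<Delta>t)) *\<^sub>R (3 *\<^sub>R w_next x - 4 *\<^sub>R u x + u_prev x)) \<theta>
        + b_form \<Omega> w_next w_next \<theta>
        + \<nu> * l2_inner \<Omega> (grad \<Omega> w_next) (grad \<Omega> \<theta>)
        = F \<theta>)"

definition bdf2_step2 ::
  "(real ^ 'n) set \<Rightarrow> nat \<Rightarrow> nat \<Rightarrow> (nat \<Rightarrow> 'n vfield) \<Rightarrow> real \<Rightarrow> real \<Rightarrow>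
     'n vfield \<Rightarrow> 'n vfield \<Rightarrow> bool" where
  "bdf2_step2 \<Omega> r R \<psi> \<nu>\<^sub>T \<Delta>t w_next u_next \<longleftrightarrow>
     u_next \<in> Xr r \<psi> \<and>
     (\<forall>\<theta>\<in>Xr r \<psi>.
        l2_inner \<Omega> (\<lambda>x. (1 / \<Delta>t) *\<^sub>R (w_next x - u_next x)) \<theta>
        = l2_inner \<Omega>
            (\<lambda>x. \<nu>\<^sub>T *\<^sub>R fluct_grad \<Omega> R \<psi> (\<lambda>y. (1/2) *\<^sub>R (w_next y + u_next y)) x)
            (fluct_grad \<Omega> R \<psi> \<theta>))"

end

theory Submission
  imports Defs
begin

text \<open>
  Testing step 1 with \<open>4 \<Delta>t w\<^sup>n\<^sup>+\<^sup>1\<close> gives the BDF2 energy identity in \<open>w\<^sup>n\<^sup>+\<^sup>1\<close>; step 2, tested with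
  \<open>(w\<^sup>n\<^sup>+\<^sup>1 + u\<^sup>n\<^sup>+\<^sup>1) / 2\<close> and \<open>u\<^sup>n\<close>, replaces \<open>w\<^sup>n\<^sup>+\<^sup>1\<close> by \<open>u\<^sup>n\<^sup>+\<^sup>1\<close> in it. Write
  \<open>z\<^sup>n = (w\<^sup>n + u\<^sup>n) / 2\<close> and \<open>F = (I - P\<^sub>R) \<nabla>\<close>. The only term without a sign is
  \<open>- 4 \<nu>\<^sub>T \<Delta>t (F z\<^sup>n\<^sup>+\<^sup>1, F u\<^sup>n)\<close>. For \<open>n \<ge> 2\<close> put \<open>u\<^sup>n = 2 z\<^sup>n - w\<^sup>n\<close>; Young's inequality then leaves
  \<open>\<parallel>2 F z\<^sup>n - F w\<^sup>n\<parallel>\<^sup>2 \<le> 4 \<parallel>F z\<^sup>n\<parallel>\<^sup>2 + \<parallel>\<nabla>w\<^sup>n\<parallel>\<^sup>2\<close>, where the cross term is dropped because step 2 makes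
  \<open>(F z\<^sup>n, F w\<^sup>n)\<close> a positive multiple of \<open>(w\<^sup>n - u\<^sup>n, w\<^sup>n) \<ge> 0\<close>. These bounds telescope, the gradient being
  absorbed by the viscous term of the previous step.

  The bound of the forcing by \<open>\<parallel>f\<parallel>\<^sub>-\<^sub>1 \<parallel>\<nabla>w\<parallel>\<close> needs \<open>w \<in> X\<close>, that is, that \<open>H\<^sub>0\<^sup>1\<close> is a linear space. As
  \<open>\<parallel>\<nabla>v\<parallel>\<close> is defined through a chosen weak gradient, this rests on the uniqueness of weak gradients and
  hence on the fundamental lemma of the calculus of variations.
\<close>

subsection \<open>The space \<open>L\<^sup>2(\<Omega>)\<close>\<close>

lemma L2_I:
  "f \<in> borel_measurable (lebesgue_on \<Omega>) \<Longrightarrow> integrable (lebesgue_on \<Omega>) (\<lambda>x. (norm (f x))\<^sup>2) \<Longrightarrow> f \<in> L2 \<Omega>"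
  by (simp add: L2_def)

lemma L2_measurable: "f \<in> L2 \<Omega> \<Longrightarrow> f \<in> borel_measurable (lebesgue_on \<Omega>)"
  by (simp add: L2_def)

text \<open>Cauchy-Schwarz and \<open>2 * a * b \<le> a\<^sup>2 + b\<^sup>2\<close> give an
  integrable majorant. This integrability is what makes \<open>l2_inner\<close> additive on
  \<open>L2 \<Omega>\<close>.\<close>

lemma L2_integrable_inner:
  assumes "f \<in> L2 \<Omega>" "g \<in> L2 \<Omega>"
  shows "integrable (lebesgue_on \<Omega>) (\<lambda>x. f x \<bullet> g x)"
proof (rule Bochner_Integration.integrable_bound)
  show "integrable (lebesgue_on \<Omega>) (\<lambda>x. (norm (f x))\<^sup>2 + (norm (g x))\<^sup>2)"
    using assms by (auto simp: L2_def)
  show "(\<lambda>x. f x \<bullet> g x) \<in> borel_measurable (lebesgue_on \<Omega>)"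
    using assms by (auto simp: L2_def)
  have "norm (f x \<bullet> g x) \<le> norm ((norm (f x))\<^sup>2 + (norm (g x))\<^sup>2)" for x
  proof -
    have "\<bar>f x \<bullet> g x\<bar> \<le> norm (f x) * norm (g x)" by (rule Cauchy_Schwarz_ineq2)
    moreover have "2 * (norm (f x) * norm (g x)) \<le> (norm (f x))\<^sup>2 + (norm (g x))\<^sup>2"
      using sum_squares_bound[of "norm (f x)" "norm (g x)"] by (simp add: mult_ac)
    moreover have "0 \<le> norm (f x) * norm (g x)" by simp
    ultimately show ?thesis by simp
  qed
  then show "AE x in lebesgue_on \<Omega>. norm (f x \<bullet> g x) \<le> norm ((norm (f x))\<^sup>2 + (norm (g x))\<^sup>2)"
    by simp
qed

lemma L2_scale: "f \<in> L2 \<Omega> \<Longrightarrow> (\<lambda>x. a *\<^sub>R f x) \<in> L2 \<Omega>"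
  by (auto simp: L2_def power_mult_distrib)

lemma L2_add:
  assumes "f \<in> L2 \<Omega>" "g \<in> L2 \<Omega>"
  shows "(\<lambda>x. f x + g x) \<in> L2 \<Omega>"
proof (rule L2_I)
  show "(\<lambda>x. f x + g x) \<in> borel_measurable (lebesgue_on \<Omega>)"
    using assms by (auto simp: L2_def)
  have "integrable (lebesgue_on \<Omega>) (\<lambda>x. f x \<bullet> f x + 2 * (f x \<bullet> g x) + g x \<bullet> g x)"
    using L2_integrable_inner assms by (intro Bochner_Integration.integrable_add integrable_mult_right)
  then show "integrable (lebesgue_on \<Omega>) (\<lambda>x. (norm (f x + g x))\<^sup>2)"
    by (simp add: power2_norm_eq_inner algebra_simps inner_commute)
qed

lemma L2_zero: "(\<lambda>x. 0) \<in> L2 \<Omega>"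
  by (simp add: L2_def)

lemma L2_diff: "f \<in> L2 \<Omega> \<Longrightarrow> g \<in> L2 \<Omega> \<Longrightarrow> (\<lambda>x. f x - g x) \<in> L2 \<Omega>"
  using L2_add[of f \<Omega> "\<lambda>x. (-1) *\<^sub>R g x"] L2_scale[of g \<Omega> "-1"] by simp

lemma L2_sum:
  "(\<And>i. i \<in> I \<Longrightarrow> f i \<in> L2 \<Omega>) \<Longrightarrow> (\<lambda>x. \<Sum>i\<in>I. f i x) \<in> L2 \<Omega>"
  by (induction I rule: infinite_finite_induct) (auto simp: L2_zero L2_add)

lemmas L2_closed = L2_scale L2_add L2_diff L2_sum L2_zero

lemma L2_bounded_linear:
  assumes T: "bounded_linear T" and f: "f \<in> L2 \<Omega>"
  shows "(\<lambda>x. T (f x)) \<in> L2 \<Omega>"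
proof (rule L2_I)
  obtain C where C: "\<And>x. norm (T x) \<le> norm x * C" "C > 0"
    using bounded_linear.pos_bounded[OF T] by blast
  show m: "(\<lambda>x. T (f x)) \<in> borel_measurable (lebesgue_on \<Omega>)"
    using f by (intro borel_measurable_continuous_on[OF bounded_linear.continuous_on[OF T]])
      (auto simp: L2_def)
  show "integrable (lebesgue_on \<Omega>) (\<lambda>x. (norm (T (f x)))\<^sup>2)"
  proof (rule Bochner_Integration.integrable_bound)
    show "integrable (lebesgue_on \<Omega>) (\<lambda>x. C\<^sup>2 * (norm (f x))\<^sup>2)"
      using f by (auto simp: L2_def)
    have "norm ((norm (T (f x)))\<^sup>2) \<le> norm (C\<^sup>2 * (norm (f x))\<^sup>2)" for x
      using power_mono[OF C(1)[of "f x"], of 2] by (simp add: power_mult_distrib mult.commute)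
    then show "AE x in lebesgue_on \<Omega>. norm ((norm (T (f x)))\<^sup>2) \<le> norm (C\<^sup>2 * (norm (f x))\<^sup>2)"
      by simp
  qed (use m in auto)
qed

lemma L2_component: "f \<in> L2 \<Omega> \<Longrightarrow> (\<lambda>x. f x $ i) \<in> L2 \<Omega>"
  by (rule L2_bounded_linear[OF bounded_linear_vec_nth])

text \<open>The field is the finite sum of its components embedded by \<open>axis i\<close>, and
  each embedding is bounded linear. Applied to rows, this puts the matrix field
  \<open>grad \<Omega> v\<close> into \<open>L2 \<Omega>\<close>.\<close>

lemma L2_vec:
  fixes f :: "'i::finite \<Rightarrow> real ^ 'n::finite \<Rightarrow> 'b::euclidean_space"
  assumes "\<And>i. f i \<in> L2 \<Omega>"
  shows "(\<lambda>x. \<chi> i. f i x) \<in> L2 \<Omega>"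
proof -
  have bl: "bounded_linear (\<lambda>y::'b. axis i y)" for i :: 'i
    by (rule linear_conv_bounded_linear[THEN iffD1])
      (auto intro!: linearI simp: axis_def vec_eq_iff)
  have "(\<lambda>x. \<Sum>i\<in>UNIV. axis i (f i x)) \<in> L2 \<Omega>"
    by (intro L2_sum L2_bounded_linear[OF bl] assms)
  also have "(\<lambda>x. \<Sum>i\<in>UNIV. axis i (f i x)) = (\<lambda>x. \<chi> i. f i x)"
    by (auto simp: vec_eq_iff axis_def fun_eq_iff if_distrib cong: if_cong)
  finally show ?thesis .
qed

section \<open>The inner product and the seminorm on square integrable fields\<close>

lemma l2_inner_commute: "l2_inner \<Omega> f g = l2_inner \<Omega> g f"
  by (simp add: l2_inner_def inner_commute)

lemma l2_inner_add_left:
  "f \<in> L2 \<Omega> \<Longrightarrow> g \<in> L2 \<Omega> \<Longrightarrow> h \<in> L2 \<Omega> \<Longrightarrow>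
     l2_inner \<Omega> (\<lambda>x. f x + g x) h = l2_inner \<Omega> f h + l2_inner \<Omega> g h"
  by (simp add: l2_inner_def inner_add_left L2_integrable_inner)

lemma l2_inner_diff_left:
  "f \<in> L2 \<Omega> \<Longrightarrow> g \<in> L2 \<Omega> \<Longrightarrow> h \<in> L2 \<Omega> \<Longrightarrow>
     l2_inner \<Omega> (\<lambda>x. f x - g x) h = l2_inner \<Omega> f h - l2_inner \<Omega> g h"
  by (simp add: l2_inner_def inner_diff_left L2_integrable_inner)

lemma l2_inner_scale_left: "l2_inner \<Omega> (\<lambda>x. a *\<^sub>R f x) h = a * l2_inner \<Omega> f h"
  by (simp add: l2_inner_def)

lemma l2_inner_add_right:
  "f \<in> L2 \<Omega> \<Longrightarrow> g \<in> L2 \<Omega> \<Longrightarrow> h \<in> L2 \<Omega> \<Longrightarrow>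
     l2_inner \<Omega> h (\<lambda>x. f x + g x) = l2_inner \<Omega> h f + l2_inner \<Omega> h g"
  by (simp add: l2_inner_def inner_add_right L2_integrable_inner)

lemma l2_inner_diff_right:
  "f \<in> L2 \<Omega> \<Longrightarrow> g \<in> L2 \<Omega> \<Longrightarrow> h \<in> L2 \<Omega> \<Longrightarrow>
     l2_inner \<Omega> h (\<lambda>x. f x - g x) = l2_inner \<Omega> h f - l2_inner \<Omega> h g"
  by (simp add: l2_inner_def inner_diff_right L2_integrable_inner)

lemma l2_inner_scale_right: "l2_inner \<Omega> h (\<lambda>x. a *\<^sub>R f x) = a * l2_inner \<Omega> h f"
  by (simp add: l2_inner_def)

lemmas l2_inner_bilinear =
  l2_inner_add_left l2_inner_diff_left l2_inner_scale_left
  l2_inner_add_right l2_inner_diff_right l2_inner_scale_right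

lemma l2_inner_self_nonneg: "0 \<le> l2_inner \<Omega> f f"
  by (simp add: l2_inner_def integral_nonneg_AE)

lemma l2_norm_sq: "(l2_norm \<Omega> f)\<^sup>2 = l2_inner \<Omega> f f"
  by (simp add: l2_norm_def l2_inner_self_nonneg)

lemma l2_norm_nonneg: "0 \<le> l2_norm \<Omega> f"
  by (simp add: l2_norm_def l2_inner_self_nonneg)

text \<open>Weak gradients are determined only up to null sets; this lets one representative be
  exchanged for another inside inner products.\<close>

lemma l2_inner_cong_AE:
  assumes "f \<in> L2 \<Omega>" "f' \<in> L2 \<Omega>" "g \<in> L2 \<Omega>" "g' \<in> L2 \<Omega>"
    and "AE x in lebesgue_on \<Omega>. f x = f' x" "AE x in lebesgue_on \<Omega>. g x = g' x"
  shows "l2_inner \<Omega> f g = l2_inner \<Omega> f' g'"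
  unfolding l2_inner_def
  by (rule integral_cong_AE) (use assms in \<open>auto simp: L2_def\<close>)

lemma l2_inner_self_zero_AE:
  assumes "f \<in> L2 \<Omega>" "l2_inner \<Omega> f f = 0"
  shows "AE x in lebesgue_on \<Omega>. f x = 0"
  using integral_nonneg_eq_0_iff_AE[OF L2_integrable_inner[OF assms(1) assms(1)]] assms(2)
  by (simp add: l2_inner_def)

text \<open>Fields are functions rather than classes, so a field of norm zero need not be the zero
  function. It is still orthogonal to everything, which settles the degenerate case of the
  projection.\<close>

lemma l2_inner_self_zero:
  assumes "f \<in> L2 \<Omega>" "g \<in> L2 \<Omega>" "l2_inner \<Omega> f f = 0"
  shows "l2_inner \<Omega> g f = 0"
proof -
  have "l2_inner \<Omega> g f = l2_inner \<Omega> g (\<lambda>x. 0)"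
    by (rule l2_inner_cong_AE) (use assms l2_inner_self_zero_AE L2_zero in auto)
  then show ?thesis by (simp add: l2_inner_def)
qed

text \<open>The gap between the two sides is the squared norm of \<open>f - g\<close>.\<close>

lemma l2_inner_add_self_le:
  assumes "f \<in> L2 \<Omega>" "g \<in> L2 \<Omega>"
  shows "l2_inner \<Omega> (\<lambda>x. f x + g x) (\<lambda>x. f x + g x) \<le> 2 * l2_inner \<Omega> f f + 2 * l2_inner \<Omega> g g"
  using l2_inner_self_nonneg[of \<Omega> "\<lambda>x. f x - g x"] assms
  by (simp add: l2_inner_bilinear L2_closed l2_inner_commute)


subsection \<open>Projection onto finite-dimensional spans\<close>

text \<open>The common shape of \<open>Xr\<close> and \<open>LR\<close>, so that closure and
  projection results are proved once. The generators may be linearly dependent.\<close>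

definition field_span :: "nat \<Rightarrow> (nat \<Rightarrow> 'a \<Rightarrow> 'b::real_vector) \<Rightarrow> ('a \<Rightarrow> 'b) set" where
  "field_span R g = {G. \<exists>c :: nat \<Rightarrow> real. G = (\<lambda>x. \<Sum>i=1..R. c i *\<^sub>R g i x)}"

lemma field_span_I: "(\<lambda>x. \<Sum>i=1..R. c i *\<^sub>R g i x) \<in> field_span R g"
  by (auto simp: field_span_def)

lemma field_span_add:
  assumes "G \<in> field_span R g" "H \<in> field_span R g"
  shows "(\<lambda>x. G x + H x) \<in> field_span R g"
proof -
  obtain c d where "G = (\<lambda>x. \<Sum>i=1..R. c i *\<^sub>R g i x)" "H = (\<lambda>x. \<Sum>i=1..R. d i *\<^sub>R g i x)"
    using assms by (auto simp: field_span_def)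
  then have "(\<lambda>x. G x + H x) = (\<lambda>x. \<Sum>i=1..R. (c i + d i) *\<^sub>R g i x)"
    by (simp add: scaleR_add_left sum.distrib)
  then show ?thesis by (simp only: field_span_I)
qed

lemma field_span_scale:
  assumes "G \<in> field_span R g"
  shows "(\<lambda>x. a *\<^sub>R G x) \<in> field_span R g"
proof -
  obtain c where "G = (\<lambda>x. \<Sum>i=1..R. c i *\<^sub>R g i x)"
    using assms by (auto simp: field_span_def)
  then have "(\<lambda>x. a *\<^sub>R G x) = (\<lambda>x. \<Sum>i=1..R. (a * c i) *\<^sub>R g i x)"
    by (simp add: scaleR_sum_right)
  then show ?thesis by (simp only: field_span_I)
qed

lemma field_span_Suc_iff:
  "G \<in> field_span (Suc R) g \<longleftrightarrow> (\<exists>H\<in>field_span R g. \<exists>a. G = (\<lambda>x. H x + a *\<^sub>R g (Suc R) x))"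
proof
  assume "G \<in> field_span (Suc R) g"
  then obtain c where "G = (\<lambda>x. \<Sum>i=1..Suc R. c i *\<^sub>R g i x)" by (auto simp: field_span_def)
  then show "\<exists>H\<in>field_span R g. \<exists>a. G = (\<lambda>x. H x + a *\<^sub>R g (Suc R) x)"
    by (intro bexI[OF _ field_span_I[where c=c and R=R]] exI[of _ "c (Suc R)"]) simp
next
  assume "\<exists>H\<in>field_span R g. \<exists>a. G = (\<lambda>x. H x + a *\<^sub>R g (Suc R) x)"
  then obtain c a where G: "G = (\<lambda>x. (\<Sum>i=1..R. c i *\<^sub>R g i x) + a *\<^sub>R g (Suc R) x)"
    by (auto simp: field_span_def)
  \<comment> \<open>The coefficient at \<open>Suc R\<close> can be overwritten by \<open>a\<close>,
    since the sum up to \<open>R\<close> never reads it.\<close>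
  have "(\<Sum>i=1..R. c i *\<^sub>R g i x) = (\<Sum>i=1..R. (c(Suc R := a)) i *\<^sub>R g i x)" for x
    by (rule sum.cong) auto
  then have "G = (\<lambda>x. \<Sum>i=1..Suc R. (c(Suc R := a)) i *\<^sub>R g i x)"
    unfolding G by (simp add: fun_eq_iff)
  then show "G \<in> field_span (Suc R) g" by (simp only: field_span_I)
qed

lemma field_span_L2:
  assumes "\<And>i. i \<in> {1..R} \<Longrightarrow> g i \<in> L2 \<Omega>" "G \<in> field_span R g"
  shows "G \<in> L2 \<Omega>"
  using assms by (auto simp: field_span_def intro!: L2_closed)

text \<open>Gram-Schmidt by induction on the number of generators: the new generator is replaced by
  its residual \<open>e\<close> after projection onto the earlier ones, and the projection of
  \<open>G\<close> is corrected along \<open>e\<close>.\<close>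

lemma l2_projection_exists:
  assumes "\<And>i. i \<in> {1..R} \<Longrightarrow> g i \<in> L2 \<Omega>" "G \<in> L2 \<Omega>"
  shows "\<exists>P\<in>field_span R g. \<forall>H\<in>field_span R g. l2_inner \<Omega> (\<lambda>x. G x - P x) H = 0"
  using assms
proof (induction R arbitrary: G)
  case 0
  then show ?case
    by (auto simp: field_span_def l2_inner_def)
next
  case (Suc R)
  have gR: "g (Suc R) \<in> L2 \<Omega>" and gi: "\<And>i. i \<in> {1..R} \<Longrightarrow> g i \<in> L2 \<Omega>"
    using Suc.prems by auto
  note inL2 = field_span_L2[OF gi]
  obtain Q where Q: "Q \<in> field_span R g" "\<And>H. H \<in> field_span R g \<Longrightarrow> l2_inner \<Omega> (\<lambda>x. g (Suc R) x - Q x) H = 0"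
    using Suc.IH[OF gi gR] by auto
  obtain P where P: "P \<in> field_span R g" "\<And>H. H \<in> field_span R g \<Longrightarrow> l2_inner \<Omega> (\<lambda>x. G x - P x) H = 0"
    using Suc.IH[OF gi Suc.prems(2)] by auto
  define e where "e = (\<lambda>x. g (Suc R) x - Q x)"
  have e: "e \<in> L2 \<Omega>" unfolding e_def by (rule L2_diff[OF gR inL2[OF _ Q(1)]])
  have eH: "l2_inner \<Omega> e H = 0" if "H \<in> field_span R g" for H
    using Q(2)[OF that] by (simp add: e_def)
  \<comment> \<open>Fourier coefficient of the remainder along \<open>e\<close>. If \<open>e\<close>
    is null, the new generator adds no direction and the coefficient 0 works, because
    \<open>e\<close> is then orthogonal to every field.\<close>
  define a where "a = (if l2_inner \<Omega> e e = 0 then 0 else l2_inner \<Omega> (\<lambda>x. G x - P x) e / l2_inner \<Omega> e e)"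
  \<comment> \<open>This is \<open>P + a e\<close>, arranged as an element of the old span plus a
    multiple of the new generator.\<close>
  define P' where "P' = (\<lambda>x. (P x + (-a) *\<^sub>R Q x) + a *\<^sub>R g (Suc R) x)"
  have P'e: "(\<lambda>x. G x - P' x) = (\<lambda>x. (G x - P x) - a *\<^sub>R e x)"
    by (auto simp: P'_def e_def algebra_simps)
  have L: "G \<in> L2 \<Omega>" "P \<in> L2 \<Omega>" "Q \<in> L2 \<Omega>" using Suc.prems P Q inL2 by auto
  have GPe: "l2_inner \<Omega> (\<lambda>x. G x - P' x) e = 0"
    using l2_inner_self_zero[OF e, of "\<lambda>x. G x - P x"] L e unfolding P'e
    by (auto simp: l2_inner_bilinear L2_closed a_def)
  have GPH: "l2_inner \<Omega> (\<lambda>x. G x - P' x) H = 0" if "H \<in> field_span R g" for H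
    using P(2)[OF that] eH[OF that] L e inL2[OF _ that] unfolding P'e
    by (simp add: l2_inner_bilinear L2_closed)
  show ?case
  proof (intro bexI[of _ P'] ballI)
    show "P' \<in> field_span (Suc R) g"
      unfolding field_span_Suc_iff P'_def
      by (rule bexI[of _ "\<lambda>x. P x + (-a) *\<^sub>R Q x"]) (use P Q in \<open>auto intro!: field_span_add field_span_scale simp del: scaleR_minus_left\<close>)
    fix H assume "H \<in> field_span (Suc R) g"
    then obtain K b where K: "K \<in> field_span R g" "H = (\<lambda>x. K x + b *\<^sub>R g (Suc R) x)"
      by (auto simp: field_span_Suc_iff)
    have H: "H = (\<lambda>x. (K x + b *\<^sub>R Q x) + b *\<^sub>R e x)"
      by (auto simp: K e_def algebra_simps)
    have KQ: "(\<lambda>x. K x + b *\<^sub>R Q x) \<in> field_span R g"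
      by (intro field_span_add field_span_scale K Q)
    have "l2_inner \<Omega> (\<lambda>x. G x - P' x) H
        = l2_inner \<Omega> (\<lambda>x. G x - P' x) (\<lambda>x. K x + b *\<^sub>R Q x) + b * l2_inner \<Omega> (\<lambda>x. G x - P' x) e"
      unfolding H
      by (subst l2_inner_add_right)
        (auto simp: l2_inner_scale_right P'_def intro!: L2_closed L e gR inL2[OF _ KQ])
    then show "l2_inner \<Omega> (\<lambda>x. G x - P' x) H = 0"
      using GPe GPH[OF KQ] by simp
  qed
qed

text \<open>Existence justifies the choice operator in \<open>l2_proj\<close>; both properties hold
  for whichever projection it selects.\<close>

lemma l2_proj_properties:
  assumes "\<And>i. i \<in> {1..R} \<Longrightarrow> g i \<in> L2 \<Omega>" "G \<in> L2 \<Omega>"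
  shows "l2_proj \<Omega> (field_span R g) G \<in> field_span R g"
    and "H \<in> field_span R g \<Longrightarrow> l2_inner \<Omega> (\<lambda>x. G x - l2_proj \<Omega> (field_span R g) G x) H = 0"
  using someI_ex[OF l2_projection_exists[OF assms, unfolded Bex_def]]
  unfolding l2_proj_def by auto

text \<open>Pythagoras: \<open>G\<close> is the sum of the orthogonal fields \<open>Q\<close> and
  its projection. Hence I - P does not increase the norm.\<close>

lemma l2_proj_complement:
  assumes "\<And>i. i \<in> {1..R} \<Longrightarrow> g i \<in> L2 \<Omega>" "G \<in> L2 \<Omega>"
  defines "Q \<equiv> \<lambda>x. G x - l2_proj \<Omega> (field_span R g) G x"
  shows "Q \<in> L2 \<Omega>" and "l2_inner \<Omega> Q Q \<le> l2_inner \<Omega> G G"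
proof -
  let ?P = "l2_proj \<Omega> (field_span R g) G"
  have P: "?P \<in> field_span R g"
      "\<And>H. H \<in> field_span R g \<Longrightarrow> l2_inner \<Omega> (\<lambda>x. G x - ?P x) H = 0"
    by (intro l2_proj_properties assms; assumption)+
  have PL: "?P \<in> L2 \<Omega>" using field_span_L2[OF assms(1) P(1)] by auto
  show QL: "Q \<in> L2 \<Omega>" unfolding Q_def by (intro L2_diff assms PL)
  have "l2_inner \<Omega> (\<lambda>x. Q x + ?P x) (\<lambda>x. Q x + ?P x)
      = l2_inner \<Omega> Q Q + 2 * l2_inner \<Omega> Q ?P + l2_inner \<Omega> ?P ?P"
    using QL PL by (simp add: l2_inner_bilinear L2_closed l2_inner_commute)
  moreover have "(\<lambda>x. Q x + ?P x) = G" by (simp add: Q_def)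
  moreover have "l2_inner \<Omega> Q ?P = 0" using P(2)[OF P(1)] by (simp add: Q_def)
  ultimately show "l2_inner \<Omega> Q Q \<le> l2_inner \<Omega> G G"
    using l2_inner_self_nonneg[of \<Omega> ?P] by simp
qed


subsection \<open>Smooth functions and test functions\<close>

lemma partial_derivI: "(f has_derivative D) (at x) \<Longrightarrow> partial_deriv i f x = D (axis i 1)"
  by (simp add: partial_deriv_def frechet_derivative_at[symmetric])

lemma C_k_Suc_imp: "C_k (Suc k) f \<Longrightarrow> C_k k f"
proof (induction k arbitrary: f)
  case 0
  then show ?case
    by (simp add: continuous_at_imp_continuous_on differentiable_imp_continuous_within)
next
  case (Suc k)
  then show ?case by (metis C_k.simps(2))
qed

lemma C_k_const: "C_k k (\<lambda>x. c)"
proof (induction k arbitrary: c)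
  case (Suc k)
  have "partial_deriv i (\<lambda>x. c) = (\<lambda>x. 0)" for i :: 'a
    by (rule ext) (rule partial_derivI[THEN trans], auto intro!: derivative_eq_intros)
  then show ?case using Suc by simp
qed simp

lemma C_k_add: "C_k k f \<Longrightarrow> C_k k g \<Longrightarrow> C_k k (\<lambda>x. f x + g x)"
proof (induction k arbitrary: f g)
  case (Suc k)
  have "partial_deriv i (\<lambda>x. f x + g x) = (\<lambda>x. partial_deriv i f x + partial_deriv i g x)" for i
  proof
    fix x
    have "f differentiable (at x)" "g differentiable (at x)" using Suc.prems by auto
    then show "partial_deriv i (\<lambda>x. f x + g x) x = partial_deriv i f x + partial_deriv i g x"
      unfolding frechet_derivative_works
      by (subst partial_derivI[OF has_derivative_add]) (auto simp: partial_deriv_def)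
  qed
  then show ?case using Suc by (auto intro!: differentiable_add)
qed (simp add: continuous_on_add)

lemma partial_deriv_mult:
  assumes "f differentiable (at x)" "g differentiable (at x)"
  shows "partial_deriv i (\<lambda>x. f x * g x) x = f x * partial_deriv i g x + partial_deriv i f x * g x"
  using assms unfolding frechet_derivative_works
  by (subst partial_derivI[OF has_derivative_mult]) (auto simp: partial_deriv_def)

lemma C_k_mult: "C_k k f \<Longrightarrow> C_k k g \<Longrightarrow> C_k k (\<lambda>x. f x * g x)"
proof (induction k arbitrary: f g)
  case (Suc k)
  have "partial_deriv i (\<lambda>x. f x * g x) = (\<lambda>x. f x * partial_deriv i g x + partial_deriv i f x * g x)" for i
    using Suc.prems by (auto simp: partial_deriv_mult)
  moreover have "C_k k f" "C_k k g" using Suc.prems by (auto intro: C_k_Suc_imp simp del: C_k.simps)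
  ultimately show ?case using Suc.prems
    by (auto intro!: differentiable_mult C_k_add Suc.IH)
qed (simp add: continuous_on_mult)

lemma C_k_sum: "(\<And>i. i \<in> I \<Longrightarrow> C_k k (f i)) \<Longrightarrow> C_k k (\<lambda>x. \<Sum>i\<in>I. f i x)"
  by (induction I rule: infinite_finite_induct) (auto simp: C_k_const C_k_add)

lemma C_k_component: "C_k k (\<lambda>x. x $ j)"
proof (cases k)
  case (Suc m)
  have d: "((\<lambda>x. x $ j) has_derivative (\<lambda>x. x $ j)) (at x)" for x :: "real ^ 'a"
    by (rule bounded_linear.has_derivative[OF bounded_linear_vec_nth has_derivative_ident])
  have "partial_deriv i (\<lambda>x. x $ j) = (\<lambda>x. axis i 1 $ j)" for i
    by (rule ext) (rule partial_derivI[OF d])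
  then show ?thesis using Suc d by (auto simp: C_k_const differentiable_def)
qed (auto intro!: continuous_intros)

text \<open>Written out in coordinates the expression is a polynomial, so the closure rules for sums
  and products apply.\<close>

lemma C_k_bump_argument: "C_k k (\<lambda>x. \<rho> - (x - c) \<bullet> (x - c))"
proof -
  have "C_k k (\<lambda>x. \<rho> + (\<Sum>j\<in>UNIV. (-1) * ((x $ j + (- c $ j)) * (x $ j + (- c $ j)))))"
    by (intro C_k_add C_k_const C_k_sum C_k_mult C_k_component)
  also have "(\<lambda>x. \<rho> + (\<Sum>j\<in>UNIV. (-1) * ((x $ j + (- c $ j)) * (x $ j + (- c $ j)))))
      = (\<lambda>x. \<rho> - (x - c) \<bullet> (x - c))"
    by (simp add: inner_vec_def sum_negf fun_eq_iff)
  finally show ?thesis .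
qed

text \<open>A partial derivative of \<open>H j\<close> composed with \<open>f\<close> is
  \<open>H (Suc j)\<close> composed with \<open>f\<close>, times a partial derivative of
  \<open>f\<close>. The induction on \<open>k\<close> therefore has to treat all \<open>j\<close> at
  once.\<close>

lemma C_k_compose:
  fixes H :: "nat \<Rightarrow> real \<Rightarrow> real"
  assumes H: "\<And>j t. (H j has_real_derivative H (Suc j) t) (at t)" and "C_k k f"
  shows "C_k k (\<lambda>x. H j (f x))"
  using assms(2)
proof (induction k arbitrary: f j)
  case 0
  have "continuous_on UNIV (H j)"
    by (intro DERIV_continuous_on[of UNIV _ "H (Suc j)"]) (use H in \<open>simp\<close>)
  then show ?case using 0 by (auto intro: continuous_on_compose2)
next
  case (Suc k)
  have f: "(f has_derivative frechet_derivative f (at x)) (at x)" for x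
    using Suc.prems by (simp add: frechet_derivative_works)
  have d: "((\<lambda>x. H j (f x)) has_derivative (\<lambda>h. H (Suc j) (f x) * frechet_derivative f (at x) h)) (at x)" for x
    using has_derivative_compose[OF f H[of j, unfolded has_field_derivative_def]] by simp
  have "partial_deriv i (\<lambda>x. H j (f x)) = (\<lambda>x. H (Suc j) (f x) * partial_deriv i f x)" for i
    by (rule ext) (simp add: partial_derivI[OF d] partial_deriv_def)
  moreover have "C_k k f" using Suc.prems by (rule C_k_Suc_imp)
  moreover have "(\<lambda>x. H j (f x)) differentiable (at x)" for x
    unfolding differentiable_def using d by blast
  ultimately show ?case using Suc.prems by (auto intro!: C_k_mult Suc.IH)
qed

section \<open>Smooth functions that are flat at the origin\<close>

text \<open>The polynomial factor makes the family closed under differentiation.\<close>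

definition flat_exp :: "real poly \<Rightarrow> real \<Rightarrow> real" where
  "flat_exp p t = (if t > 0 then poly p (1 / t) * exp (- (1 / t)) else 0)"

lemma poly_times_exp_tendsto_0: "((\<lambda>s. poly p s * exp (- s)) \<longlongrightarrow> 0) at_top" for p :: "real poly"
proof -
  have "((\<lambda>s. \<Sum>i\<le>degree p. coeff p i * (s ^ i / exp s)) \<longlongrightarrow> (\<Sum>i\<le>degree p. coeff p i * 0)) at_top"
    by (intro tendsto_sum tendsto_mult tendsto_const tendsto_power_div_exp_0)
  then show ?thesis
    by (simp add: poly_altdef sum_distrib_left exp_minus divide_inverse mult_ac)
qed

text \<open>With s = 1/t the chain rule turns p(s) exp(-s) into s^2 (p(s) - p'(s)) exp(-s), which
  explains the polynomial factor for t > 0. At 0 the exponential decay beats every power of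
  s.\<close>

lemma flat_exp_has_derivative:
  "(flat_exp p has_real_derivative flat_exp ([:0, 0, 1:] * (p - pderiv p)) t) (at t)"
proof (cases t "0 :: real" rule: linorder_cases)
  case greater
  have "((\<lambda>t. poly p (1 / t) * exp (- (1 / t))) has_real_derivative
      flat_exp ([:0, 0, 1:] * (p - pderiv p)) t) (at t)"
    using greater
    by (auto intro!: derivative_eq_intros DERIV_chain2[OF poly_DERIV]
        simp: flat_exp_def power2_eq_square field_simps)
  then show ?thesis
    by (rule has_field_derivative_transform_within_open[of _ _ _ "{0<..}"])
      (use greater in \<open>auto simp: flat_exp_def\<close>)
next
  case less
  have "((\<lambda>t. 0) has_real_derivative 0) (at t)" by simp
  then have "(flat_exp p has_real_derivative 0) (at t)"
    by (rule has_field_derivative_transform_within_open[of _ _ _ "{..<0}"])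
      (use less in \<open>auto simp: flat_exp_def\<close>)
  then show ?thesis using less by (simp add: flat_exp_def)
next
  case equal
  have "((\<lambda>h. flat_exp p h / h) \<longlongrightarrow> 0) (at_right 0)"
  proof -
    \<comment> \<open>\<open>pCons 0 p\<close> is s p(s): dividing by h contributes one more factor
      s = 1/h.\<close>
    have "((\<lambda>h. poly (pCons 0 p) (inverse h) * exp (- inverse h)) \<longlongrightarrow> 0) (at_right (0::real))"
      by (rule filterlim_compose[OF poly_times_exp_tendsto_0 filterlim_inverse_at_top_right])
    then show ?thesis
      by (rule Lim_transform_eventually)
        (auto simp: eventually_at_right_less flat_exp_def field_simps
          intro!: eventually_mono[OF eventually_at_right_less[of 0]])
  qed
  moreover have "((\<lambda>h. flat_exp p h / h) \<longlongrightarrow> 0) (at_left 0)"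
    by (rule Lim_transform_eventually[OF tendsto_const])
      (auto simp: flat_exp_def eventually_at_filter intro!: always_eventually)
  ultimately have "((\<lambda>h. flat_exp p h / h) \<longlongrightarrow> 0) (at 0)"
    by (simp add: filterlim_split_at)
  then show ?thesis
    using equal by (simp add: DERIV_def flat_exp_def)
qed

lemma C_k_flat_exp: "C_k k f \<Longrightarrow> C_k k (\<lambda>x. flat_exp p (f x))"
proof -
  assume f: "C_k k f"
  \<comment> \<open>\<open>H j\<close> is the j-th derivative of \<open>flat_exp p\<close>, again a
    member of the family.\<close>
  define H where "H j = flat_exp (((\<lambda>q. [:0, 0, 1:] * (q - pderiv q)) ^^ j) p)" for j
  have "(H j has_real_derivative H (Suc j) t) (at t)" for j t
    unfolding H_def by (simp only: funpow.simps o_apply) (rule flat_exp_has_derivative)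
  from C_k_compose[of H, OF this f, of 0] show ?thesis by (simp add: H_def)
qed

section \<open>Algebra, regularity and integrability of test functions\<close>

lemma test_functionsI:
  "(\<And>k. C_k k \<phi>) \<Longrightarrow> compact K \<Longrightarrow> K \<subseteq> \<Omega> \<Longrightarrow> (\<And>x. x \<notin> K \<Longrightarrow> \<phi> x = 0) \<Longrightarrow> \<phi> \<in> test_functions \<Omega>"
  unfolding test_functions_def by blast

lemma test_functionsE:
  assumes "\<phi> \<in> test_functions \<Omega>"
  obtains K where "compact K" "K \<subseteq> \<Omega>" "\<And>x. x \<notin> K \<Longrightarrow> \<phi> x = 0" "\<And>k. C_k k \<phi>"
  using assms unfolding test_functions_def by blast

lemma test_functions_scale: "\<phi> \<in> test_functions \<Omega> \<Longrightarrow> (\<lambda>x. a * \<phi> x) \<in> test_functions \<Omega>"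
  by (erule test_functionsE) (rule test_functionsI, auto intro!: C_k_mult C_k_const)

lemma test_functions_mult:
  assumes "\<phi> \<in> test_functions \<Omega>" "\<theta> \<in> test_functions \<Omega>"
  shows "(\<lambda>x. \<phi> x * \<theta> x) \<in> test_functions \<Omega>"
  using assms(1)
proof (rule test_functionsE)
  fix K assume K: "compact K" "K \<subseteq> \<Omega>" "\<And>x. x \<notin> K \<Longrightarrow> \<phi> x = 0" "\<And>k. C_k k \<phi>"
  moreover have "C_k k \<theta>" for k using assms(2) by (simp add: test_functions_def)
  ultimately show ?thesis by (intro test_functionsI[of _ K]) (auto intro: C_k_mult)
qed

lemma test_functions_add:
  assumes "\<phi> \<in> test_functions \<Omega>" "\<theta> \<in> test_functions \<Omega>"
  shows "(\<lambda>x. \<phi> x + \<theta> x) \<in> test_functions \<Omega>"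
proof -
  obtain K where K: "compact K" "K \<subseteq> \<Omega>" "\<And>x. x \<notin> K \<Longrightarrow> \<phi> x = 0" "\<And>k. C_k k \<phi>"
    using assms(1) unfolding test_functions_def by blast
  obtain L where L: "compact L" "L \<subseteq> \<Omega>" "\<And>x. x \<notin> L \<Longrightarrow> \<theta> x = 0" "\<And>k. C_k k \<theta>"
    using assms(2) unfolding test_functions_def by blast
  show ?thesis
    by (rule test_functionsI[of _ "K \<union> L"]) (use K L in \<open>auto intro: C_k_add\<close>)
qed

lemma test_functions_partial_deriv:
  assumes "\<phi> \<in> test_functions \<Omega>"
  shows "partial_deriv i \<phi> \<in> test_functions \<Omega>"
  using assms
proof (rule test_functionsE)
  fix K assume K: "compact K" "K \<subseteq> \<Omega>" "\<And>x. x \<notin> K \<Longrightarrow> \<phi> x = 0" "\<And>k. C_k k \<phi>"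
  have "C_k k (partial_deriv i \<phi>)" for k using K(4)[of "Suc k"] by simp
  moreover have "partial_deriv i \<phi> x = 0" if "x \<notin> K" for x
  proof -
    \<comment> \<open>The complement of the compact set \<open>K\<close> is open, so
      \<open>\<phi>\<close> vanishes in a whole neighbourhood of \<open>x\<close>.\<close>
    have "(\<phi> has_derivative (\<lambda>h. 0)) (at x)"
      by (rule has_derivative_transform_within_open[of "\<lambda>x. 0" _ _ _ "- K"])
        (use K that in \<open>auto simp: open_Compl compact_imp_closed\<close>)
    then show ?thesis by (simp add: partial_derivI)
  qed
  ultimately show ?thesis using K by (intro test_functionsI[of _ K])
qed

lemma test_functions_differentiable: "\<phi> \<in> test_functions \<Omega> \<Longrightarrow> \<phi> differentiable (at x)"
  by (erule test_functionsE) (metis C_k.simps(2))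

lemma test_functions_continuous: "\<phi> \<in> test_functions \<Omega> \<Longrightarrow> continuous_on UNIV \<phi>"
  by (erule test_functionsE) (metis C_k.simps(1))

lemma test_functions_bounded:
  assumes "\<phi> \<in> test_functions \<Omega>"
  obtains B where "B > 0" "\<And>x. \<bar>\<phi> x\<bar> \<le> B"
proof -
  obtain K where K: "compact K" "\<And>x. x \<notin> K \<Longrightarrow> \<phi> x = 0"
    using assms unfolding test_functions_def by blast
  have "bounded (\<phi> ` K)"
    using K test_functions_continuous[OF assms]
    by (intro compact_imp_bounded compact_continuous_image) (auto intro: continuous_on_subset)
  then obtain B where "B > 0" "\<And>x. x \<in> K \<Longrightarrow> \<bar>\<phi> x\<bar> \<le> B"
    unfolding bounded_pos by auto
  with K(2) show ?thesis by (intro that[of B]) (metis abs_zero less_eq_real_def)+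
qed

lemma test_functions_integrable:
  assumes "\<phi> \<in> test_functions \<Omega>"
  shows "integrable lborel \<phi>"
proof -
  obtain K where K: "compact K" "\<And>x. x \<notin> K \<Longrightarrow> \<phi> x = 0"
    using assms unfolding test_functions_def by blast
  have "integrable lborel (\<lambda>x. indicator K x *\<^sub>R \<phi> x)"
    by (rule borel_integrable_compact) (use K test_functions_continuous[OF assms] in \<open>auto intro: continuous_on_subset\<close>)
  also have "(\<lambda>x. indicator K x *\<^sub>R \<phi> x) = \<phi>" using K by (auto simp: indicator_def fun_eq_iff)
  finally show ?thesis .
qed

lemma integrable_lebesgue_on_of_lborel:
  fixes f :: "real ^ 'n \<Rightarrow> real"
  assumes "integrable lborel f" "\<Omega> \<in> sets lebesgue"
  shows "integrable (lebesgue_on \<Omega>) f"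
proof -
  have "integrable lebesgue f"
    using assms(1) by (simp add: integrable_completion borel_measurable_integrable)
  then show ?thesis
    using integrable_mult_indicator[OF assms(2), of f] assms(2) by (simp add: integrable_restrict_space)
qed

lemma test_functions_L2:
  assumes "\<phi> \<in> test_functions \<Omega>" "\<Omega>' \<in> sets lebesgue"
  shows "\<phi> \<in> L2 \<Omega>'"
proof (rule L2_I)
  have "\<phi> \<in> borel_measurable lborel"
    using test_functions_continuous[OF assms(1)] by (simp add: borel_measurable_continuous_onI)
  then have "\<phi> \<in> borel_measurable lebesgue" by (rule measurable_completion)
  then show "\<phi> \<in> borel_measurable (lebesgue_on \<Omega>')" by (rule measurable_restrict_space1)
  show "integrable (lebesgue_on \<Omega>') (\<lambda>x. (norm (\<phi> x))\<^sup>2)"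
    using integrable_lebesgue_on_of_lborel[OF test_functions_integrable[OF test_functions_mult[OF assms(1) assms(1)]] assms(2)]
    by (simp add: power2_eq_square)
qed

lemma test_functions_L2_open: "\<phi> \<in> test_functions \<Omega> \<Longrightarrow> open \<Omega> \<Longrightarrow> \<phi> \<in> L2 \<Omega>"
  by (erule test_functions_L2) simp

lemma test_functions_integral:
  assumes "\<phi> \<in> test_functions \<Omega>" "open \<Omega>"
  shows "(LINT x|lebesgue_on \<Omega>. \<phi> x) = (LINT x|lborel. \<phi> x)"
proof -
  have "(\<lambda>x. indicator \<Omega> x *\<^sub>R \<phi> x) = \<phi>"
    using assms(1) by (elim test_functionsE) (auto simp: indicator_def fun_eq_iff)
  moreover have "(LINT x|lebesgue_on \<Omega>. \<phi> x) = (LINT x|lebesgue. indicator \<Omega> x *\<^sub>R \<phi> x)"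
    using assms(2) by (subst integral_restrict_space) auto
  ultimately have "(LINT x|lebesgue_on \<Omega>. \<phi> x) = (LINT x|lebesgue. \<phi> x)"
    by simp
  also have "\<dots> = (LINT x|lborel. \<phi> x)"
    using test_functions_integrable[OF assms(1)] by (simp add: integral_completion)
  finally show ?thesis .
qed

section \<open>Integration by parts for test functions\<close>

lemma lborel_integral_translate:
  fixes p :: "'a::euclidean_space \<Rightarrow> real"
  assumes "integrable lborel p"
  shows "integrable lborel (\<lambda>x. p (x + c))" "(LINT x|lborel. p (x + c)) = (LINT x|lborel. p x)"
proof -
  have m: "p \<in> borel_measurable borel" using assms by auto
  have "integrable (distr lborel borel ((+) c)) p" using assms by (simp add: lborel_distr_plus)
  then show "integrable lborel (\<lambda>x. p (x + c))"
    by (subst (asm) integrable_distr_eq) (use m in \<open>auto simp: add.commute\<close>)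
  have "(LINT x|lborel. p x) = (LINT x|distr lborel borel ((+) c). p x)" by (simp add: lborel_distr_plus)
  also have "\<dots> = (LINT x|lborel. p (c + x))" by (rule integral_distr) (use m in auto)
  finally show "(LINT x|lborel. p (x + c)) = (LINT x|lborel. p x)" by (simp add: add.commute)
qed

text \<open>Difference quotients have integral zero by translation invariance, and dominated
  convergence carries this to their limit, the partial derivative.\<close>

lemma integral_partial_deriv_test_function:
  assumes p: "p \<in> test_functions \<Omega>"
  shows "(LINT x|lborel. partial_deriv i p x) = 0"
proof -
  define e :: "real ^ 'a" where "e = axis i 1"
  define s where "s n x = (p (x + (1 / real (Suc n)) *\<^sub>R e) - p x) / (1 / real (Suc n))" for n x
  have ne: "norm e = 1" by (simp add: e_def norm_axis_1)
  have line: "((\<lambda>t. p (x + t *\<^sub>R e)) has_real_derivative partial_deriv i p (x + t *\<^sub>R e)) (at t)" for x t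
  proof -
    have d: "(p has_derivative frechet_derivative p (at y)) (at y)" for y
      using test_functions_differentiable[OF p] by (simp add: frechet_derivative_works)
    have g: "((\<lambda>t. x + t *\<^sub>R e) has_derivative (\<lambda>h. h *\<^sub>R e)) (at t)"
      by (auto intro!: derivative_eq_intros)
    have "frechet_derivative p (at y) (h *\<^sub>R e) = h * partial_deriv i p y" for h y
      using linear_cmul[OF has_derivative_linear[OF d]] by (simp add: partial_deriv_def e_def)
    then show ?thesis
      using has_derivative_compose[OF g d] by (simp add: has_field_derivative_def mult.commute[of "partial_deriv _ _ _"] mult_commute_abs)
  qed
  obtain B where B: "B > 0" "\<And>x. \<bar>partial_deriv i p x\<bar> \<le> B"
    using test_functions_bounded[OF test_functions_partial_deriv[OF p, of i]] by blast
  obtain K where K: "compact K" "\<And>x. x \<notin> K \<Longrightarrow> p x = 0" using p unfolding test_functions_def by blast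
  obtain r where r: "\<And>x. x \<in> K \<Longrightarrow> norm x \<le> r"
    using compact_imp_bounded[OF K(1)] unfolding bounded_iff by auto
  have "(\<lambda>n. LINT x|lborel. s n x) \<longlonglongrightarrow> (LINT x|lborel. partial_deriv i p x)"
  \<comment> \<open>The mean value theorem bounds every quotient by \<open>B\<close>. The increments
    are at most 1 in length, so the quotients vanish outside the support ball enlarged by 1.\<close>
  proof (rule integral_dominated_convergence[where w="\<lambda>x. B * indicator (cball 0 (r + 1)) x"])
    have c: "continuous_on UNIV p" "continuous_on UNIV (partial_deriv i p)"
      using test_functions_continuous p test_functions_partial_deriv by blast+
    show "partial_deriv i p \<in> borel_measurable lborel"
      using c by (simp add: borel_measurable_continuous_onI)
    show "s n \<in> borel_measurable lborel" for n
    proof -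
      have "continuous_on UNIV (s n)"
        unfolding s_def by (intro continuous_intros continuous_on_compose2[OF c(1)] c) auto
      then show ?thesis by (simp add: borel_measurable_continuous_onI)
    qed
    show "integrable lborel (\<lambda>x. B * indicator (cball 0 (r + 1)) x :: real)"
      by (rule integrable_mult_right, rule integrable_real_indicator) (use emeasure_lborel_cball_finite[of 0 "r + 1"] in auto)
    show "AE x in lborel. (\<lambda>n. s n x) \<longlonglongrightarrow> partial_deriv i p x"
    proof (rule AE_I2)
      fix x
      have "((\<lambda>h. (p (x + h *\<^sub>R e) - p x) / h) \<longlongrightarrow> partial_deriv i p x) (at 0)"
        using line[of x 0] by (simp add: DERIV_def)
      moreover have "filterlim (\<lambda>n. 1 / real (Suc n)) (at 0) sequentially"
        using LIMSEQ_inverse_real_of_nat by (simp add: filterlim_at inverse_eq_divide)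
      ultimately show "(\<lambda>n. s n x) \<longlonglongrightarrow> partial_deriv i p x"
        unfolding s_def by (rule filterlim_compose)
    qed
    show "AE x in lborel. norm (s n x) \<le> B * indicator (cball 0 (r + 1)) x" for n
    proof (rule AE_I2)
      fix x :: "real ^ 'a"
      define h where "h = 1 / real (Suc n)"
      have h: "0 < h" "h \<le> 1" by (auto simp: h_def)
      obtain z where z: "p (x + h *\<^sub>R e) - p (x + 0 *\<^sub>R e) = (h - 0) * partial_deriv i p (x + z *\<^sub>R e)"
        using MVT2[OF h(1), of "\<lambda>t. p (x + t *\<^sub>R e)" "\<lambda>t. partial_deriv i p (x + t *\<^sub>R e)"] line by auto
      have sh: "s n x = (p (x + h *\<^sub>R e) - p x) / h" by (simp only: s_def h_def)
      with z h have s: "s n x = partial_deriv i p (x + z *\<^sub>R e)" by simp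
      show "norm (s n x) \<le> B * indicator (cball 0 (r + 1)) x"
      proof (cases "norm x \<le> r + 1")
        case True
        then show ?thesis using B(2) by (simp add: s)
      next
        case False
        have "norm x \<le> norm (x + h *\<^sub>R e) + h"
          using norm_triangle_ineq4[of "x + h *\<^sub>R e" "h *\<^sub>R e"] ne h by simp
        then have "x \<notin> K" "x + h *\<^sub>R e \<notin> K"
          using False h r[of x] r[of "x + h *\<^sub>R e"] by auto
        then show ?thesis using False K(2) by (simp add: sh)
      qed
    qed
  qed
  moreover have "(LINT x|lborel. s n x) = 0" for n
    unfolding s_def using lborel_integral_translate[OF test_functions_integrable[OF p]] test_functions_integrable[OF p]
    by simp
  ultimately show ?thesis by (simp add: LIMSEQ_const_iff)
qed

text \<open>The product is again a test function; the product rule splits its partial derivative,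
  whose integral is zero.\<close>

lemma integration_by_parts_test_functions:
  assumes "\<phi> \<in> test_functions \<Omega>" "\<theta> \<in> test_functions \<Omega>" "open \<Omega>"
  shows "l2_inner \<Omega> \<phi> (partial_deriv i \<theta>) = - l2_inner \<Omega> (partial_deriv i \<phi>) \<theta>"
proof -
  note t = test_functions_mult[OF assms(1,2)]
  have "(LINT x|lebesgue_on \<Omega>. partial_deriv i (\<lambda>x. \<phi> x * \<theta> x) x) = 0"
    using test_functions_integral[OF test_functions_partial_deriv[OF t] assms(3)]
      integral_partial_deriv_test_function[OF t] by simp
  moreover have "partial_deriv i (\<lambda>x. \<phi> x * \<theta> x) x = \<phi> x \<bullet> partial_deriv i \<theta> x + partial_deriv i \<phi> x \<bullet> \<theta> x" for x
    using assms by (simp add: partial_deriv_mult test_functions_differentiable)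
  moreover have "integrable (lebesgue_on \<Omega>) (\<lambda>x. \<phi> x \<bullet> partial_deriv i \<theta> x)"
      "integrable (lebesgue_on \<Omega>) (\<lambda>x. partial_deriv i \<phi> x \<bullet> \<theta> x)"
    by (intro L2_integrable_inner test_functions_L2_open test_functions_partial_deriv assms)+
  ultimately show ?thesis
    by (simp add: l2_inner_def del: inner_real_def)
qed


subsection \<open>The fundamental lemma of the calculus of variations\<close>

lemma flat_exp_1_limit_at_top: "((\<lambda>t. flat_exp 1 t) \<longlongrightarrow> 1) at_top"
proof -
  have "((\<lambda>t. exp (- (1 / t))) \<longlongrightarrow> exp (- 0)) (at_top :: real filter)"
    by (intro tendsto_intros tendsto_divide_0[OF tendsto_const] filterlim_at_top_imp_at_infinity filterlim_ident)
  then have "((\<lambda>t. exp (- (1 / t))) \<longlongrightarrow> 1) (at_top :: real filter)" by simp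
  then show ?thesis
    by (rule Lim_transform_eventually)
      (auto simp: flat_exp_def intro: eventually_mono[OF eventually_gt_at_top[of 0]])
qed

lemma flat_exp_1_bounds: "0 \<le> flat_exp 1 t" "flat_exp 1 t \<le> 1" "0 < t \<Longrightarrow> 0 < flat_exp 1 t"
  "t \<le> 0 \<Longrightarrow> flat_exp 1 t = 0"
  by (auto simp: flat_exp_def)

text \<open>
  Cover \<open>U\<close> by countably many balls with bumps \<open>b\<^sub>i\<close>; as \<open>flat_exp 1\<close> vanishes on \<open>t \<le> 0\<close> and tends to 1
  at infinity, \<open>flat_exp 1 (n (b\<^sub>0 + ... + b\<^sub>n\<^sub>-\<^sub>1))\<close> tends to the indicator.
\<close>

lemma indicator_limit_test_functions:
  fixes U :: "(real ^ 'n) set"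
  assumes "open U"
  obtains \<phi> :: "nat \<Rightarrow> real ^ 'n \<Rightarrow> real" where
    "\<And>n. \<phi> n \<in> test_functions U" "\<And>n x. 0 \<le> \<phi> n x" "\<And>n x. \<phi> n x \<le> 1"
    "\<And>x. (\<lambda>n. \<phi> n x) \<longlonglongrightarrow> indicator U x"
proof (cases "U = {}")
  case True
  have "(\<lambda>x. 0) \<in> test_functions U"
    by (rule test_functionsI[of _ "{}"]) (auto simp: C_k_const)
  then show ?thesis by (intro that[of "\<lambda>n x. 0"]) (auto simp: True)
next
  case False
  \<comment> \<open>Requiring the closed balls to lie in \<open>U\<close> gives each bump a compact
    support inside \<open>U\<close>.\<close>
  define F where "F = {ball c r |c r. 0 < r \<and> cball c r \<subseteq> U}"
  obtain F' where F': "F' \<subseteq> F" "countable F'" "\<Union>F' = \<Union>F"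
    by (rule Lindelof[of F]) (auto simp: F_def)
  have U: "\<Union>F = U"
  proof
    show "\<Union>F \<subseteq> U" unfolding F_def using ball_subset_cball by blast
    show "U \<subseteq> \<Union>F"
    proof
      fix x assume "x \<in> U"
      then obtain e where "0 < e" "cball x e \<subseteq> U"
        using assms open_contains_cball by blast
      then show "x \<in> \<Union>F" unfolding F_def by (auto intro!: exI[of _ "ball x e"])
    qed
  qed
  have ne: "F' \<noteq> {}" using False F' U by auto
  have "\<exists>c r. from_nat_into F' n = ball c r \<and> 0 < r \<and> cball c r \<subseteq> U" for n
    using from_nat_into[OF ne, of n] F'(1) unfolding F_def by blast
  then obtain c r where cr: "\<And>n. from_nat_into F' n = ball (c n) (r n)" "\<And>n. 0 < r n"
      "\<And>n. cball (c n) (r n) \<subseteq> U"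
    by metis
  \<comment> \<open>Squared radius minus squared distance is positive exactly on the open ball, so
    the same holds for the bump.\<close>
  define b where "b i x = flat_exp 1 ((r i)\<^sup>2 - (x - c i) \<bullet> (x - c i))" for i x
  define \<phi> where "\<phi> n x = flat_exp 1 (real n * (\<Sum>i<n. b i x))" for n x
  have arg: "(x - c i) \<bullet> (x - c i) = (dist (c i) x)\<^sup>2" for i x
    by (simp add: dist_norm norm_minus_commute power2_norm_eq_inner)
  have b0: "b i x = 0" if "x \<notin> cball (c i) (r i)" for i x
    using that cr(2)[of i] power_mono[of "r i" "dist (c i) x" 2]
    by (auto simp: b_def arg intro!: flat_exp_1_bounds)
  have bpos: "0 < b i x" if "x \<in> ball (c i) (r i)" for i x
    using that cr(2)[of i] power_strict_mono[of "dist (c i) x" "r i" 2]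
    by (auto simp: b_def arg intro!: flat_exp_1_bounds)
  have bnn: "0 \<le> b i x" for i x by (simp add: b_def flat_exp_1_bounds)
  show ?thesis
  proof (rule that[of \<phi>])
    fix n
    show "\<phi> n \<in> test_functions U"
    proof (rule test_functionsI[of _ "\<Union>i<n. cball (c i) (r i)"])
      show "C_k k (\<phi> n)" for k
        unfolding \<phi>_def b_def
        by (intro C_k_flat_exp C_k_mult C_k_const C_k_sum C_k_bump_argument)
      show "\<phi> n x = 0" if "x \<notin> (\<Union>i<n. cball (c i) (r i))" for x
        using that b0 by (auto simp: \<phi>_def intro!: flat_exp_1_bounds sum_nonpos mult_nonneg_nonpos)
      show "(\<Union>i<n. cball (c i) (r i)) \<subseteq> U" using cr(3) by (rule UN_least)
    qed auto
    fix x
    show "0 \<le> \<phi> n x" "\<phi> n x \<le> 1" by (simp_all add: \<phi>_def flat_exp_1_bounds)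
  next
    fix x
    show "(\<lambda>n. \<phi> n x) \<longlonglongrightarrow> indicator U x"
    proof (cases "x \<in> U")
      case True
      then have "x \<in> \<Union>(range (from_nat_into F'))"
        using range_from_nat_into[OF ne F'(2)] F'(3) U by simp
      then obtain j where j: "x \<in> ball (c j) (r j)" using cr(1) by auto
      \<comment> \<open>A single ball containing \<open>x\<close> suffices: all bumps are
        nonnegative, so once \<open>n > j\<close> the sum dominates the j-th one.\<close>
      have le: "real n * b j x \<le> real n * (\<Sum>i<n. b i x)" if "n > j" for n
        using that bnn by (intro mult_left_mono member_le_sum) auto
      have "filterlim (\<lambda>n. real n * b j x) at_top sequentially"
        using bpos[OF j] by (intro filterlim_at_top_mult_tendsto_pos[OF tendsto_const] filterlim_real_sequentially)
          (auto simp: mult.commute)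
      then have "filterlim (\<lambda>n. real n * (\<Sum>i<n. b i x)) at_top sequentially"
        by (rule filterlim_at_top_mono) (use le in \<open>auto intro: eventually_mono[OF eventually_gt_at_top[of j]]\<close>)
      then show ?thesis
        using True unfolding \<phi>_def by (simp add: filterlim_compose[OF flat_exp_1_limit_at_top])
    next
      case F: False
      have "b i x = 0" for i using F cr(3)[of i] by (intro b0) blast
      then have "\<phi> n x = 0" for n by (simp add: \<phi>_def flat_exp_1_bounds)
      then show ?thesis using F by simp
    qed
  qed
qed

text \<open>Open sets form an intersection-stable generator of the Borel sets, so vanishing
  integrals spread to all Borel sets by a Dynkin argument; a density with all integrals zero is zero
  almost everywhere.\<close>

lemma AE_zero_if_open_integrals_zero:
  fixes f :: "'a::euclidean_space \<Rightarrow> real"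
  assumes f: "integrable lborel f"
    and 0: "\<And>U. open U \<Longrightarrow> (LINT x:U|lborel. f x) = 0"
  shows "AE x in lborel. f x = 0"
proof (rule sigma_finite_measure.density_zero[OF lborel.sigma_finite_measure_axioms f])
  have si: "set_integrable lborel A f" if "A \<in> sets borel" for A
    unfolding set_integrable_def using that f by (intro integrable_mult_indicator) auto
  fix A :: "'a set" assume "A \<in> sets lborel"
  then have A: "A \<in> sigma_sets UNIV {S. open S}" by (simp add: borel_def)
  have "Int_stable {S :: 'a set. open S}" by (auto simp: Int_stable_def)
  moreover have "{S :: 'a set. open S} \<subseteq> Pow UNIV" by simp
  ultimately show "(LINT x:A|lborel. f x) = 0"
    using A
  proof (induction A rule: sigma_sets_induct_disjoint)
    case (basic A) then show ?case using 0 by simp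
  next
    case empty show ?case by (simp add: set_lebesgue_integral_def)
  next
    case (compl A)
    then have A: "A \<in> sets borel" by (simp add: borel_def)
    have "(LINT x:A \<union> (UNIV - A)|lborel. f x) = (LINT x:A|lborel. f x) + (LINT x:UNIV - A|lborel. f x)"
      using A by (intro set_integral_Un si) auto
    moreover have "A \<union> (UNIV - A) = UNIV" by auto
    ultimately show ?case using compl 0[of UNIV] by simp
  next
    case (union A)
    then have A: "A i \<in> sets borel" for i using union by (auto simp: borel_def)
    have "(LINT x:(\<Union>i. A i)|lborel. f x) = (\<Sum>i. (LINT x:(A i)|lborel. f x))"
      using union(1) A by (intro lebesgue_integral_countable_add si) (auto simp: disjoint_family_on_def)
    then show ?case using union by simp
  qed
qed

text \<open>A bounded domain has finite measure, so 1 + d^2 is an integrable majorant.\<close>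

lemma L2_integrable:
  fixes d :: "real ^ 'n \<Rightarrow> real"
  assumes "d \<in> L2 \<Omega>" "open \<Omega>" "bounded \<Omega>"
  shows "integrable (lebesgue_on \<Omega>) d"
proof (rule Bochner_Integration.integrable_bound)
  have "\<Omega> \<in> lmeasurable" using assms by (simp add: lmeasurable_open)
  then have "integrable (lebesgue_on \<Omega>) (\<lambda>x. 1 :: real)"
    by (simp add: integrable_restrict_space lmeasurable_iff_integrable fmeasurableD mult.commute)
  then show "integrable (lebesgue_on \<Omega>) (\<lambda>x. 1 + (norm (d x))\<^sup>2)"
    using assms(1) by (auto simp: L2_def)
  show "d \<in> borel_measurable (lebesgue_on \<Omega>)" using assms(1) by (rule L2_measurable)
  have "\<bar>d x\<bar> \<le> \<bar>1 + (d x)\<^sup>2\<bar>" for x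
    using sum_squares_bound[of "1" "\<bar>d x\<bar>"] by (simp add: power2_eq_square)
  then show "AE x in lebesgue_on \<Omega>. norm (d x) \<le> norm (1 + (norm (d x))\<^sup>2)" by simp
qed

text \<open>Extend \<open>d\<close> by zero and pass to a Borel representative \<open>g\<close>.
  Test functions increasing the resolution of the indicator of \<open>U \<inter> \<Omega>\<close>
  show, by dominated convergence, that \<open>g\<close> integrates to zero over each open
  \<open>U\<close>; then \<open>AE_zero_if_open_integrals_zero\<close> applies.\<close>

lemma fundamental_lemma_calculus_of_variations:
  fixes d :: "real ^ 'n \<Rightarrow> real"
  assumes d: "integrable (lebesgue_on \<Omega>) d" and \<Omega>: "open \<Omega>"
    and 0: "\<And>\<phi>. \<phi> \<in> test_functions \<Omega> \<Longrightarrow> l2_inner \<Omega> d \<phi> = 0"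
  shows "AE x in lebesgue_on \<Omega>. d x = 0"
proof -
  have \<Omega>': "\<Omega> \<in> sets lebesgue" using \<Omega> by simp
  define f where "f x = indicator \<Omega> x * d x" for x
  have f: "integrable lebesgue f"
    using d \<Omega>' by (simp add: f_def[abs_def] integrable_restrict_space)
  \<comment> \<open>The extension is only Lebesgue measurable, while the Dynkin argument runs over
    Borel sets with \<open>lborel\<close>.\<close>
  obtain g where g: "g \<in> borel_measurable lborel" "AE x in lborel. f x = g x"
    using completion_ex_borel_measurable_real[of f lborel] f by auto
  have fg: "AE x in lebesgue. f x = g x" using g(2) by (rule AE_completion)
  have gl: "g \<in> borel_measurable lebesgue" using g(1) by (rule measurable_completion)
  have "integrable lebesgue g"
    using f by (rule integrable_cong_AE_imp) (use fg gl in auto)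
  then have gi: "integrable lborel g" using g(1) by (simp add: integrable_completion)
  have "(LINT x:U|lborel. g x) = 0" if U: "open U" for U
  proof -
    obtain \<phi> where \<phi>: "\<And>n. \<phi> n \<in> test_functions (U \<inter> \<Omega>)" "\<And>n x. 0 \<le> \<phi> n x"
        "\<And>n x. \<phi> n x \<le> 1" "\<And>x. (\<lambda>n. \<phi> n x) \<longlonglongrightarrow> indicator (U \<inter> \<Omega>) x"
      using indicator_limit_test_functions[of "U \<inter> \<Omega>"] U \<Omega> by auto
    have T: "\<phi> n \<in> test_functions \<Omega>" for n
      using \<phi>(1)[of n] by (auto simp: test_functions_def)
    have m: "\<phi> n \<in> borel_measurable (lebesgue_on \<Omega>)" for n
      by (rule L2_measurable[OF test_functions_L2[OF T \<Omega>']])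
    have dm: "d \<in> borel_measurable (lebesgue_on \<Omega>)" using d by auto
    have Um: "indicator (U \<inter> \<Omega>) \<in> borel_measurable (lebesgue_on \<Omega>)"
      using U \<Omega> by (intro measurable_restrict_space1 borel_measurable_indicator) auto
    have "(\<lambda>n. LINT x|lebesgue_on \<Omega>. d x * \<phi> n x) \<longlonglongrightarrow> (LINT x|lebesgue_on \<Omega>. d x * indicator (U \<inter> \<Omega>) x)"
    proof (rule integral_dominated_convergence[where w="\<lambda>x. \<bar>d x\<bar>"])
      show "AE x in lebesgue_on \<Omega>. (\<lambda>n. d x * \<phi> n x) \<longlonglongrightarrow> d x * indicator (U \<inter> \<Omega>) x"
        using \<phi>(4) by (intro AE_I2 tendsto_mult tendsto_const)
      have "\<bar>d x * \<phi> n x\<bar> \<le> \<bar>d x\<bar>" for n x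
        using \<phi>(2,3)[of n x] by (simp add: abs_mult mult_left_le)
      then show "AE x in lebesgue_on \<Omega>. norm (d x * \<phi> n x) \<le> \<bar>d x\<bar>" for n by simp
      show "(\<lambda>x. d x * indicator (U \<inter> \<Omega>) x) \<in> borel_measurable (lebesgue_on \<Omega>)"
        using dm Um by (rule borel_measurable_times)
    qed (use m d dm in auto)
    then have "(LINT x|lebesgue_on \<Omega>. d x * indicator (U \<inter> \<Omega>) x) = 0"
      using 0[OF T] by (simp add: l2_inner_def LIMSEQ_const_iff)
    moreover have "(LINT x|lebesgue_on \<Omega>. d x * indicator (U \<inter> \<Omega>) x)
        = (LINT x|lebesgue. indicator \<Omega> x *\<^sub>R (d x * indicator (U \<inter> \<Omega>) x))"
      using \<Omega>' by (subst integral_restrict_space) auto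
    moreover have "\<dots> = (LINT x|lebesgue. indicator U x * f x)"
      by (rule Bochner_Integration.integral_cong) (auto simp: f_def indicator_def)
    moreover have "\<dots> = (LINT x|lebesgue. indicator U x * g x)"
    proof (rule integral_cong_AE)
      have "(indicator U :: _ \<Rightarrow> real) \<in> borel_measurable lebesgue"
        using U by (intro borel_measurable_indicator) auto
      then show "(\<lambda>x. indicator U x * f x) \<in> borel_measurable lebesgue"
        "(\<lambda>x. indicator U x * g x) \<in> borel_measurable lebesgue"
        using f gl by auto
    qed (use fg in auto)
    moreover have "\<dots> = (LINT x|lborel. indicator U x * g x)"
      using g(1) U by (intro integral_completion) auto
    ultimately show ?thesis by (simp add: set_lebesgue_integral_def)
  qed
  from AE_zero_if_open_integrals_zero[OF gi this] have "AE x in lebesgue. g x = 0"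
    by (intro AE_completion) auto
  with fg have "AE x in lebesgue. f x = 0" by auto
  then have "AE x in lebesgue. x \<in> \<Omega> \<longrightarrow> d x = 0"
    by (rule AE_mp) (auto simp: f_def)
  then show ?thesis using \<Omega>' by (simp add: AE_restrict_space_iff)
qed


subsection \<open>\<open>H\<^sub>0\<^sup>1(\<Omega>)\<close> as a linear space\<close>

text \<open>Each component of the difference of two weak gradients annihilates all test
  functions.\<close>

lemma weak_gradient_unique:
  assumes \<Omega>: "open \<Omega>" "bounded \<Omega>"
    and g: "has_weak_gradient \<Omega> v g" and h: "has_weak_gradient \<Omega> v h"
  shows "AE x in lebesgue_on \<Omega>. g x = h x"
proof -
  have L: "g \<in> L2 \<Omega>" "h \<in> L2 \<Omega>" using g h by (auto simp: has_weak_gradient_def)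
  have "AE x in lebesgue_on \<Omega>. g x $ i - h x $ i = 0" for i
  proof (rule fundamental_lemma_calculus_of_variations[OF L2_integrable[OF _ \<Omega>] \<Omega>(1)])
    show "(\<lambda>x. g x $ i - h x $ i) \<in> L2 \<Omega>" using L by (intro L2_diff L2_component)
    fix \<phi> assume \<phi>: "\<phi> \<in> test_functions \<Omega>"
    then have "\<phi> \<in> L2 \<Omega>" using \<Omega> by (intro test_functions_L2_open)
    then have "l2_inner \<Omega> (\<lambda>x. g x $ i - h x $ i) \<phi> = l2_inner \<Omega> (\<lambda>x. g x $ i) \<phi> - l2_inner \<Omega> (\<lambda>x. h x $ i) \<phi>"
      using L by (intro l2_inner_diff_left L2_component)
    moreover have "l2_inner \<Omega> (\<lambda>x. g x $ i) \<phi> = - l2_inner \<Omega> v (partial_deriv i \<phi>)"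
      "l2_inner \<Omega> (\<lambda>x. h x $ i) \<phi> = - l2_inner \<Omega> v (partial_deriv i \<phi>)"
      using g h \<phi> by (auto simp: has_weak_gradient_def)
    ultimately show "l2_inner \<Omega> (\<lambda>x. g x $ i - h x $ i) \<phi> = 0" by simp
  qed
  then have "AE x in lebesgue_on \<Omega>. \<forall>i\<in>UNIV. g x $ i - h x $ i = 0"
    by (intro AE_finite_allI) auto
  then show ?thesis by (simp add: vec_eq_iff)
qed

lemma has_weak_gradient_linear:
  assumes \<Omega>: "open \<Omega>" and L: "u \<in> L2 \<Omega>" "v \<in> L2 \<Omega>"
    and g: "has_weak_gradient \<Omega> u g" and h: "has_weak_gradient \<Omega> v h"
  shows "has_weak_gradient \<Omega> (\<lambda>x. a *\<^sub>R u x + b *\<^sub>R v x) (\<lambda>x. a *\<^sub>R g x + b *\<^sub>R h x)"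
  unfolding has_weak_gradient_def
proof (intro conjI ballI allI)
  have gh: "g \<in> L2 \<Omega>" "h \<in> L2 \<Omega>" using g h by (auto simp: has_weak_gradient_def)
  then show "(\<lambda>x. a *\<^sub>R g x + b *\<^sub>R h x) \<in> L2 \<Omega>" by (intro L2_closed)
  fix \<phi> i assume \<phi>: "\<phi> \<in> test_functions \<Omega>"
  have T: "\<phi> \<in> L2 \<Omega>" "partial_deriv i \<phi> \<in> L2 \<Omega>"
    using \<phi> \<Omega> by (auto intro: test_functions_L2_open test_functions_partial_deriv)
  have eq: "l2_inner \<Omega> u (partial_deriv i \<phi>) = - l2_inner \<Omega> (\<lambda>x. g x $ i) \<phi>"
      "l2_inner \<Omega> v (partial_deriv i \<phi>) = - l2_inner \<Omega> (\<lambda>x. h x $ i) \<phi>"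
    using g h \<phi> by (auto simp: has_weak_gradient_def)
  have "l2_inner \<Omega> (\<lambda>x. a *\<^sub>R u x + b *\<^sub>R v x) (partial_deriv i \<phi>)
      = a * l2_inner \<Omega> u (partial_deriv i \<phi>) + b * l2_inner \<Omega> v (partial_deriv i \<phi>)"
    using L T by (subst l2_inner_add_left) (auto simp only: l2_inner_scale_left intro!: L2_closed)
  also have "\<dots> = - (a * l2_inner \<Omega> (\<lambda>x. g x $ i) \<phi> + b * l2_inner \<Omega> (\<lambda>x. h x $ i) \<phi>)"
    by (simp add: eq)
  also have "a * l2_inner \<Omega> (\<lambda>x. g x $ i) \<phi> + b * l2_inner \<Omega> (\<lambda>x. h x $ i) \<phi>
      = l2_inner \<Omega> (\<lambda>x. a *\<^sub>R g x $ i + b *\<^sub>R h x $ i) \<phi>"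
    using gh T by (subst l2_inner_add_left) (auto simp only: l2_inner_scale_left intro!: L2_closed L2_component)
  finally show "l2_inner \<Omega> (\<lambda>x. a *\<^sub>R u x + b *\<^sub>R v x) (partial_deriv i \<phi>)
      = - l2_inner \<Omega> (\<lambda>x. (a *\<^sub>R g x + b *\<^sub>R h x) $ i) \<phi>" by simp
qed

lemma test_function_has_weak_gradient:
  assumes "\<phi> \<in> test_functions \<Omega>" "open \<Omega>"
  shows "has_weak_gradient \<Omega> \<phi> (\<lambda>x. \<chi> i. partial_deriv i \<phi> x)"
  unfolding has_weak_gradient_def
  using assms by (auto intro!: L2_vec test_functions_L2_open test_functions_partial_deriv
      integration_by_parts_test_functions)

lemma test_functions_H1: "\<phi> \<in> test_functions \<Omega> \<Longrightarrow> open \<Omega> \<Longrightarrow> \<phi> \<in> H1 \<Omega>"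
  unfolding H1_def using test_function_has_weak_gradient test_functions_L2_open by blast

lemma weak_grad_properties: "v \<in> H1 \<Omega> \<Longrightarrow> has_weak_gradient \<Omega> v (weak_grad \<Omega> v)"
  unfolding H1_def weak_grad_def by (metis (mono_tags, lifting) mem_Collect_eq someI_ex)

lemma H1_linear:
  "open \<Omega> \<Longrightarrow> u \<in> H1 \<Omega> \<Longrightarrow> v \<in> H1 \<Omega> \<Longrightarrow> (\<lambda>x. a *\<^sub>R u x + b *\<^sub>R v x) \<in> H1 \<Omega>"
  unfolding H1_def using has_weak_gradient_linear by (fastforce intro!: L2_closed)

lemma h1_norm_sq: "(h1_norm \<Omega> v)\<^sup>2 = l2_inner \<Omega> v v + l2_inner \<Omega> (weak_grad \<Omega> v) (weak_grad \<Omega> v)"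
  by (simp add: h1_norm_def l2_norm_sq l2_inner_self_nonneg)

text \<open>\<open>weak_grad\<close> of a combination is a separate choice, equal to the combination
  of the chosen gradients only almost everywhere. The bound with factor 2 takes the place of a
  triangle inequality.\<close>

lemma h1_norm_linear_le:
  assumes \<Omega>: "open \<Omega>" "bounded \<Omega>" and u: "u \<in> H1 \<Omega>" and v: "v \<in> H1 \<Omega>"
  shows "(h1_norm \<Omega> (\<lambda>x. a *\<^sub>R u x + b *\<^sub>R v x))\<^sup>2 \<le> 2 * a\<^sup>2 * (h1_norm \<Omega> u)\<^sup>2 + 2 * b\<^sup>2 * (h1_norm \<Omega> v)\<^sup>2"
proof -
  note gu = weak_grad_properties[OF u] and gv = weak_grad_properties[OF v]
  note gw = weak_grad_properties[OF H1_linear[OF \<Omega>(1) u v, of a b]]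
  have L: "u \<in> L2 \<Omega>" "v \<in> L2 \<Omega>" "weak_grad \<Omega> u \<in> L2 \<Omega>" "weak_grad \<Omega> v \<in> L2 \<Omega>"
      "weak_grad \<Omega> (\<lambda>x. a *\<^sub>R u x + b *\<^sub>R v x) \<in> L2 \<Omega>"
    using u v gu gv gw by (auto simp: H1_def has_weak_gradient_def)
  have AE: "AE x in lebesgue_on \<Omega>. weak_grad \<Omega> (\<lambda>x. a *\<^sub>R u x + b *\<^sub>R v x) x
      = a *\<^sub>R weak_grad \<Omega> u x + b *\<^sub>R weak_grad \<Omega> v x"
    by (rule weak_gradient_unique[OF \<Omega> gw has_weak_gradient_linear[OF \<Omega>(1) L(1,2) gu gv]])
  have sq: "l2_inner \<Omega> (\<lambda>x. a *\<^sub>R p x + b *\<^sub>R q x) (\<lambda>x. a *\<^sub>R p x + b *\<^sub>R q x)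
      \<le> 2 * a\<^sup>2 * l2_inner \<Omega> p p + 2 * b\<^sup>2 * l2_inner \<Omega> q q"
    if "p \<in> L2 \<Omega>" "q \<in> L2 \<Omega>" for p q :: "real ^ 'a \<Rightarrow> 'c::euclidean_space"
    using l2_inner_add_self_le[of "\<lambda>x. a *\<^sub>R p x" \<Omega> "\<lambda>x. b *\<^sub>R q x"] that
    by (simp only: l2_inner_scale_left l2_inner_scale_right L2_scale power2_eq_square mult.assoc)
  have "l2_inner \<Omega> (weak_grad \<Omega> (\<lambda>x. a *\<^sub>R u x + b *\<^sub>R v x)) (weak_grad \<Omega> (\<lambda>x. a *\<^sub>R u x + b *\<^sub>R v x))
      = l2_inner \<Omega> (\<lambda>x. a *\<^sub>R weak_grad \<Omega> u x + b *\<^sub>R weak_grad \<Omega> v x)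
          (\<lambda>x. a *\<^sub>R weak_grad \<Omega> u x + b *\<^sub>R weak_grad \<Omega> v x)"
    by (rule l2_inner_cong_AE) (use L AE in \<open>auto intro!: L2_closed\<close>)
  then show ?thesis
    using sq[OF L(1,2)] sq[OF L(3,4)] unfolding h1_norm_sq by (simp add: algebra_simps)
qed

lemma zero_in_H10:
  assumes \<Omega>: "open \<Omega>" "bounded \<Omega>"
  shows "(\<lambda>x. 0) \<in> H10 \<Omega>"
proof -
  have T: "(\<lambda>x. 0) \<in> test_functions \<Omega>"
    by (rule test_functionsI[of _ "{}"]) (auto simp: C_k_const)
  note H1 = test_functions_H1[OF T \<Omega>(1)]
  \<comment> \<open>The chosen weak gradient of 0 need not be the zero function, so the norm is
    evaluated through a combination with both coefficients 0.\<close>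
  have "(h1_norm \<Omega> (\<lambda>x. 0 *\<^sub>R 0 + 0 *\<^sub>R 0))\<^sup>2 \<le> 2 * 0\<^sup>2 * (h1_norm \<Omega> (\<lambda>x. 0))\<^sup>2 + 2 * 0\<^sup>2 * (h1_norm \<Omega> (\<lambda>x. 0))\<^sup>2"
    by (rule h1_norm_linear_le[OF \<Omega> H1 H1])
  then have "h1_norm \<Omega> (\<lambda>x. 0) = 0" by simp
  then show ?thesis
    unfolding H10_def using H1 T by (auto intro!: bexI[of _ "\<lambda>x. 0"])
qed

text \<open>If \<open>p\<close> and \<open>q\<close> approximate \<open>u\<close> and
  \<open>v\<close>, then the same combination of \<open>p\<close> and \<open>q\<close> approximates
  that of \<open>u\<close> and \<open>v\<close>.\<close>

lemma H10_linear:
  assumes \<Omega>: "open \<Omega>" "bounded \<Omega>" and u: "u \<in> H10 \<Omega>" and v: "v \<in> H10 \<Omega>"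
  shows "(\<lambda>x. a *\<^sub>R u x + b *\<^sub>R v x) \<in> H10 \<Omega>"
proof -
  have H1: "u \<in> H1 \<Omega>" "v \<in> H1 \<Omega>" using u v by (auto simp: H10_def)
  have "\<exists>\<phi>\<in>test_functions \<Omega>. h1_norm \<Omega> (\<lambda>x. (a *\<^sub>R u x + b *\<^sub>R v x) - \<phi> x) < \<epsilon>" if \<epsilon>: "\<epsilon> > 0" for \<epsilon>
  proof -
    \<comment> \<open>Chosen so that the final bound is exactly \<open>\<epsilon>\<^sup>2\<close>;
      the summand 1 keeps the denominator positive when \<open>a = b = 0\<close>.\<close>
    define \<delta> where "\<delta> = \<epsilon> / (2 * (\<bar>a\<bar> + \<bar>b\<bar> + 1))"
    have \<delta>: "\<delta> > 0" using \<epsilon> by (simp add: \<delta>_def)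
    obtain p where p: "p \<in> test_functions \<Omega>" "h1_norm \<Omega> (\<lambda>x. u x - p x) < \<delta>"
      using u \<delta> by (auto simp: H10_def)
    obtain q where q: "q \<in> test_functions \<Omega>" "h1_norm \<Omega> (\<lambda>x. v x - q x) < \<delta>"
      using v \<delta> by (auto simp: H10_def)
    define \<phi> where "\<phi> x = a * p x + b * q x" for x
    have "\<phi> \<in> test_functions \<Omega>"
      unfolding \<phi>_def by (intro test_functions_add test_functions_scale p q)
    have up: "(\<lambda>x. u x - p x) \<in> H1 \<Omega>"
      using H1_linear[OF \<Omega>(1) H1(1) test_functions_H1[OF p(1) \<Omega>(1)], of 1 "-1"] by simp
    have vq: "(\<lambda>x. v x - q x) \<in> H1 \<Omega>"
      using H1_linear[OF \<Omega>(1) H1(2) test_functions_H1[OF q(1) \<Omega>(1)], of 1 "-1"] by simp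
    have nn: "0 \<le> h1_norm \<Omega> w" for w by (simp add: h1_norm_def)
    have eq: "(\<lambda>x. (a *\<^sub>R u x + b *\<^sub>R v x) - \<phi> x) = (\<lambda>x. a *\<^sub>R (u x - p x) + b *\<^sub>R (v x - q x))"
      by (auto simp: \<phi>_def algebra_simps)
    have "(h1_norm \<Omega> (\<lambda>x. (a *\<^sub>R u x + b *\<^sub>R v x) - \<phi> x))\<^sup>2
        \<le> 2 * a\<^sup>2 * (h1_norm \<Omega> (\<lambda>x. u x - p x))\<^sup>2 + 2 * b\<^sup>2 * (h1_norm \<Omega> (\<lambda>x. v x - q x))\<^sup>2"
      unfolding eq by (rule h1_norm_linear_le[OF \<Omega> up vq])
    also have "\<dots> \<le> 2 * a\<^sup>2 * \<delta>\<^sup>2 + 2 * b\<^sup>2 * \<delta>\<^sup>2"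
      using p(2) q(2) nn by (intro add_mono mult_left_mono power_mono) (auto intro: less_imp_le)
    also have "\<dots> < (2 * (\<bar>a\<bar> + \<bar>b\<bar> + 1))\<^sup>2 * \<delta>\<^sup>2"
    proof -
      have "2 * a\<^sup>2 + 2 * b\<^sup>2 < (2 * (\<bar>a\<bar> + \<bar>b\<bar> + 1))\<^sup>2"
      proof -
        have "(2 * (\<bar>a\<bar> + \<bar>b\<bar> + 1))\<^sup>2 = 4 * a\<^sup>2 + 4 * b\<^sup>2 + 8 * (\<bar>a\<bar> * \<bar>b\<bar>) + 8 * \<bar>a\<bar> + 8 * \<bar>b\<bar> + 4"
          by (simp add: power2_eq_square algebra_simps abs_mult_self_eq)
        moreover have "0 \<le> \<bar>a\<bar> * \<bar>b\<bar>" by simp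
        ultimately show ?thesis using zero_le_power2[of a] zero_le_power2[of b] by linarith
      qed
      then show ?thesis using \<delta> by (simp flip: distrib_right)
    qed
    also have "\<dots> = \<epsilon>\<^sup>2"
      unfolding power_mult_distrib[symmetric] by (simp add: \<delta>_def)
    finally have "h1_norm \<Omega> (\<lambda>x. (a *\<^sub>R u x + b *\<^sub>R v x) - \<phi> x) < \<epsilon>"
      using \<epsilon> by (simp add: power_less_imp_less_base)
    then show ?thesis using \<open>\<phi> \<in> test_functions \<Omega>\<close> by blast
  qed
  then show ?thesis
    unfolding H10_def using H1_linear[OF \<Omega>(1) H1] by blast
qed

section \<open>The velocity space and the spans it contains\<close>

lemma X_space_linear:
  assumes "open \<Omega>" "bounded \<Omega>" "u \<in> X_space \<Omega>" "v \<in> X_space \<Omega>"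
  shows "(\<lambda>x. a *\<^sub>R u x + b *\<^sub>R v x) \<in> X_space \<Omega>"
  using H10_linear[OF assms(1,2)] assms(3,4) by (simp add: X_space_def)

lemma X_space_span:
  assumes \<Omega>: "open \<Omega>" "bounded \<Omega>" and "\<And>i. i \<in> {1..r} \<Longrightarrow> \<psi> i \<in> X_space \<Omega>" "v \<in> field_span r \<psi>"
  shows "v \<in> X_space \<Omega>"
  using assms(3,4)
proof (induction r arbitrary: v)
  case 0
  then have "v = (\<lambda>x. 0)" by (simp add: field_span_def)
  then show ?case using zero_in_H10[OF \<Omega>] by (simp add: X_space_def)
next
  case (Suc r)
  then obtain u a where "u \<in> field_span r \<psi>" "v = (\<lambda>x. 1 *\<^sub>R u x + a *\<^sub>R \<psi> (Suc r) x)"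
    by (auto simp: field_span_Suc_iff)
  then show ?case using Suc by (auto intro!: X_space_linear \<Omega> simp del: scaleR_one)
qed

lemma X_space_L2:
  assumes "v \<in> X_space \<Omega>"
  shows "v \<in> L2 \<Omega>"
  using L2_vec[of "\<lambda>i x. v x $ i" \<Omega>] assms by (simp add: X_space_def H10_def H1_def)

lemma X_space_grad_L2:
  assumes "v \<in> X_space \<Omega>"
  shows "grad \<Omega> v \<in> L2 \<Omega>"
  unfolding grad_def[abs_def] using assms weak_grad_properties
  by (intro L2_vec) (auto simp: X_space_def H10_def has_weak_gradient_def)


subsection \<open>Energy estimates for one time step\<close>

text \<open>Boundedness of \<open>F\<close> makes the supremum in \<open>Hm1_norm\<close> a genuine
  upper bound of the quotients.\<close>

lemma Hm1_bound:
  assumes "F \<in> Hm1 \<Omega>" "v \<in> X_space \<Omega>"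
  shows "\<bar>F v\<bar> \<le> Hm1_norm \<Omega> F * l2_norm \<Omega> (grad \<Omega> v)"
proof -
  obtain C where C: "\<And>v. v \<in> X_space \<Omega> \<Longrightarrow> \<bar>F v\<bar> \<le> C * l2_norm \<Omega> (grad \<Omega> v)"
    using assms(1) unfolding Hm1_def by blast
  \<comment> \<open>\<open>C\<close> may be negative, hence \<open>\<bar>C\<bar>\<close>. Where the
    gradient norm is zero, the quotient is 0 by the convention for division.\<close>
  have q: "\<bar>F v\<bar> / l2_norm \<Omega> (grad \<Omega> v) \<le> \<bar>C\<bar>" if "v \<in> X_space \<Omega>" for v
  proof (cases "l2_norm \<Omega> (grad \<Omega> v) = 0")
    case False
    then have p: "l2_norm \<Omega> (grad \<Omega> v) > 0" using l2_norm_nonneg[of \<Omega> "grad \<Omega> v"] by simp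
    have "\<bar>F v\<bar> \<le> \<bar>C\<bar> * l2_norm \<Omega> (grad \<Omega> v)"
      using C[OF that] p by (meson abs_ge_self less_imp_le mult_right_mono order_trans)
    with p show ?thesis by (simp add: divide_le_eq)
  qed simp
  have "\<bar>F v\<bar> / l2_norm \<Omega> (grad \<Omega> v) \<le> Hm1_norm \<Omega> F"
    unfolding Hm1_norm_def using q by (intro cSUP_upper[OF assms(2)] bdd_aboveI2)
  \<comment> \<open>If the gradient norm vanishes the quotient carries no information, but the bound
    with \<open>C\<close> forces \<open>F v = 0\<close>.\<close>
  then show ?thesis
    using C[OF assms(2)] l2_norm_nonneg[of \<Omega> "grad \<Omega> v"]
    by (cases "l2_norm \<Omega> (grad \<Omega> v) = 0") (auto simp: divide_le_eq split: if_splits)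
qed

lemma b_form_skew: "b_form \<Omega> u v v = 0"
  by (simp add: b_form_def)

lemma Xr_eq_field_span: "Xr r \<psi> = field_span r \<psi>"
  by (simp add: Xr_def field_span_def)

lemma LR_eq_field_span: "LR \<Omega> R \<psi> = field_span R (\<lambda>i. grad \<Omega> (\<psi> i))"
  by (simp add: LR_def field_span_def)

text \<open>Instance of \<open>l2_proj_complement\<close> for the span of the POD gradients; it
  trades fluctuations for full gradients, which viscosity controls.\<close>

lemma fluct_grad_bound:
  assumes "\<And>i. i \<in> {1..R} \<Longrightarrow> \<psi> i \<in> X_space \<Omega>" "v \<in> X_space \<Omega>"
  shows "fluct_grad \<Omega> R \<psi> v \<in> L2 \<Omega>"
    and "l2_inner \<Omega> (fluct_grad \<Omega> R \<psi> v) (fluct_grad \<Omega> R \<psi> v) \<le> l2_inner \<Omega> (grad \<Omega> v) (grad \<Omega> v)"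
proof -
  have g: "grad \<Omega> (\<psi> i) \<in> L2 \<Omega>" if "i \<in> {1..R}" for i
    using X_space_grad_L2[OF assms(1)[OF that]] .
  have "fluct_grad \<Omega> R \<psi> v = (\<lambda>x. grad \<Omega> v x - l2_proj \<Omega> (field_span R (\<lambda>i. grad \<Omega> (\<psi> i))) (grad \<Omega> v) x)"
    by (simp add: fun_eq_iff fluct_grad_def LR_eq_field_span)
  then show "fluct_grad \<Omega> R \<psi> v \<in> L2 \<Omega>"
    and "l2_inner \<Omega> (fluct_grad \<Omega> R \<psi> v) (fluct_grad \<Omega> R \<psi> v) \<le> l2_inner \<Omega> (grad \<Omega> v) (grad \<Omega> v)"
    using l2_proj_complement[of R "\<lambda>i. grad \<Omega> (\<psi> i)", OF g X_space_grad_L2[OF assms(2)]] by auto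
qed

text \<open>Testing with \<open>w\<close> itself removes the convective term by skew symmetry. Half
  of the viscous term absorbs the forcing and the other half stays on the left.\<close>

lemma bdf2_step1_energy:
  assumes step: "bdf2_step1 \<Omega> r \<psi> \<nu> \<Delta>t F u' u w"
    and X: "u' \<in> X_space \<Omega>" "u \<in> X_space \<Omega>" "w \<in> X_space \<Omega>"
    and pos: "\<nu> > 0" "\<Delta>t > 0" and F: "F \<in> Hm1 \<Omega>"
  shows "(l2_norm \<Omega> w)\<^sup>2 + (l2_norm \<Omega> (\<lambda>x. 2 *\<^sub>R w x - u x))\<^sup>2
      + (l2_norm \<Omega> (\<lambda>x. w x - 2 *\<^sub>R u x + u' x))\<^sup>2 + 2 * \<nu> * \<Delta>t * (l2_norm \<Omega> (grad \<Omega> w))\<^sup>2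
    \<le> (l2_norm \<Omega> u)\<^sup>2 + (l2_norm \<Omega> (\<lambda>x. 2 *\<^sub>R u x - u' x))\<^sup>2
      + 2 * inverse \<nu> * \<Delta>t * (Hm1_norm \<Omega> F)\<^sup>2"
proof -
  note L = X[THEN X_space_L2]
  define g N where "g = l2_norm \<Omega> (grad \<Omega> w)" and "N = Hm1_norm \<Omega> F"
  define A where "A = 3 * l2_inner \<Omega> w w - 4 * l2_inner \<Omega> u w + l2_inner \<Omega> u' w"
  have "l2_inner \<Omega> (\<lambda>x. (1 / (2 * \<Delta>t)) *\<^sub>R (3 *\<^sub>R w x - 4 *\<^sub>R u x + u' x)) w
      + \<nu> * g\<^sup>2 = F w"
    using step by (auto simp: bdf2_step1_def b_form_skew g_def l2_norm_sq)
  moreover have "l2_inner \<Omega> (\<lambda>x. 3 *\<^sub>R w x - 4 *\<^sub>R u x + u' x) w = A"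
    using L by (simp add: l2_inner_bilinear L2_closed A_def)
  ultimately have "A / (2 * \<Delta>t) + \<nu> * g\<^sup>2 = F w"
    unfolding l2_inner_scale_left by simp
  then have "A + 2 * \<Delta>t * (\<nu> * g\<^sup>2) = 2 * \<Delta>t * F w"
    using pos by (simp add: field_simps)
  moreover have "2 * \<Delta>t * F w \<le> 2 * \<Delta>t * (N * g)"
    using Hm1_bound[OF F X(3)] pos by (simp add: g_def N_def)
  \<comment> \<open>Young's inequality weighted by the viscosity, from the square of
    \<open>\<nu> * g - N\<close>.\<close>
  moreover have "2 * \<Delta>t * (2 * (N * g)) \<le> 2 * \<Delta>t * (\<nu> * g\<^sup>2 + inverse \<nu> * N\<^sup>2)"
  proof (rule mult_left_mono)
    have "0 \<le> inverse \<nu> * (\<nu> * g - N)\<^sup>2" using pos by simp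
    also have "\<dots> = \<nu> * g\<^sup>2 + inverse \<nu> * N\<^sup>2 - 2 * (N * g)"
      using pos by (simp add: power2_eq_square field_simps)
    finally show "2 * (N * g) \<le> \<nu> * g\<^sup>2 + inverse \<nu> * N\<^sup>2" by simp
  qed (use pos in simp)
  \<comment> \<open>The algebraic identity behind the G-stability of BDF2.\<close>
  moreover have "l2_inner \<Omega> w w + l2_inner \<Omega> (\<lambda>x. 2 *\<^sub>R w x - u x) (\<lambda>x. 2 *\<^sub>R w x - u x)
      + l2_inner \<Omega> (\<lambda>x. w x - 2 *\<^sub>R u x + u' x) (\<lambda>x. w x - 2 *\<^sub>R u x + u' x)
      - l2_inner \<Omega> u u - l2_inner \<Omega> (\<lambda>x. 2 *\<^sub>R u x - u' x) (\<lambda>x. 2 *\<^sub>R u x - u' x)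
      = 2 * A"
    unfolding A_def using L by (simp add: l2_inner_bilinear L2_closed l2_inner_commute[of \<Omega> w u]
        l2_inner_commute[of \<Omega> w u'] l2_inner_commute[of \<Omega> u u'] algebra_simps)
  ultimately show ?thesis
    unfolding g_def[symmetric] N_def[symmetric] l2_norm_sq by (simp add: algebra_simps)
qed

section \<open>Energy relations from the post-processing step\<close>

lemma bdf2_step2_test:
  assumes "bdf2_step2 \<Omega> r R \<psi> \<nu>\<^sub>T \<Delta>t w u" "\<Delta>t > 0" "\<theta> \<in> Xr r \<psi>"
  shows "l2_inner \<Omega> (\<lambda>x. w x - u x) \<theta>
    = \<nu>\<^sub>T * \<Delta>t * l2_inner \<Omega> (fluct_grad \<Omega> R \<psi> (\<lambda>x. (1/2) *\<^sub>R (w x + u x))) (fluct_grad \<Omega> R \<psi> \<theta>)"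
proof -
  have "(1 / \<Delta>t) * l2_inner \<Omega> (\<lambda>x. w x - u x) \<theta> = \<nu>\<^sub>T *
      l2_inner \<Omega> (fluct_grad \<Omega> R \<psi> (\<lambda>x. (1/2) *\<^sub>R (w x + u x))) (fluct_grad \<Omega> R \<psi> \<theta>)"
    using assms(1,3) unfolding bdf2_step2_def l2_inner_scale_left by blast
  then show ?thesis using assms(2) by (simp add: divide_eq_eq mult_ac)
qed

lemma Xr_midpoint:
  assumes "w \<in> Xr r \<psi>" "u \<in> Xr r \<psi>"
  shows "(\<lambda>x. (1/2) *\<^sub>R (w x + u x)) \<in> Xr r \<psi>"
  using assms unfolding Xr_eq_field_span by (intro field_span_scale field_span_add)

text \<open>Testing with the midpoint gives a difference of squares. The extrapolated norms
  contribute four more copies of that difference, which explains the factor 10, and leave the inner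
  product with \<open>v\<close>, which stands for the previous velocity.\<close>

lemma bdf2_step2_energy:
  assumes step: "bdf2_step2 \<Omega> r R \<psi> \<nu>\<^sub>T \<Delta>t w u" and pos: "\<Delta>t > 0"
    and Xr: "w \<in> Xr r \<psi>" "u \<in> Xr r \<psi>" "v \<in> Xr r \<psi>"
    and L: "w \<in> L2 \<Omega>" "u \<in> L2 \<Omega>" "v \<in> L2 \<Omega>"
  defines "Z \<equiv> fluct_grad \<Omega> R \<psi> (\<lambda>x. (1/2) *\<^sub>R (w x + u x))"
  shows "(l2_norm \<Omega> w)\<^sup>2 - (l2_norm \<Omega> u)\<^sup>2 = 2 * \<nu>\<^sub>T * \<Delta>t * (l2_norm \<Omega> Z)\<^sup>2"
    and "(l2_norm \<Omega> w)\<^sup>2 + (l2_norm \<Omega> (\<lambda>x. 2 *\<^sub>R w x - v x))\<^sup>2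
      - (l2_norm \<Omega> u)\<^sup>2 - (l2_norm \<Omega> (\<lambda>x. 2 *\<^sub>R u x - v x))\<^sup>2
      = 10 * \<nu>\<^sub>T * \<Delta>t * (l2_norm \<Omega> Z)\<^sup>2 - 4 * l2_inner \<Omega> (\<lambda>x. w x - u x) v"
proof -
  have "l2_inner \<Omega> (\<lambda>x. w x - u x) (\<lambda>x. (1/2) *\<^sub>R (w x + u x)) = \<nu>\<^sub>T * \<Delta>t * (l2_norm \<Omega> Z)\<^sup>2"
    unfolding Z_def l2_norm_sq by (rule bdf2_step2_test[OF step pos Xr_midpoint[OF Xr(1,2)]])
  moreover have "l2_inner \<Omega> (\<lambda>x. w x - u x) (\<lambda>x. (1/2) *\<^sub>R (w x + u x))
      = (1/2) * (l2_inner \<Omega> w w - l2_inner \<Omega> u u)"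
    unfolding l2_inner_scale_right using L by (simp add: l2_inner_bilinear L2_closed l2_inner_commute)
  ultimately show e: "(l2_norm \<Omega> w)\<^sup>2 - (l2_norm \<Omega> u)\<^sup>2 = 2 * \<nu>\<^sub>T * \<Delta>t * (l2_norm \<Omega> Z)\<^sup>2"
    by (simp add: l2_norm_sq)
  have "(l2_norm \<Omega> (\<lambda>x. 2 *\<^sub>R w x - v x))\<^sup>2 - (l2_norm \<Omega> (\<lambda>x. 2 *\<^sub>R u x - v x))\<^sup>2
      = 4 * ((l2_norm \<Omega> w)\<^sup>2 - (l2_norm \<Omega> u)\<^sup>2) - 4 * l2_inner \<Omega> (\<lambda>x. w x - u x) v"
    unfolding l2_norm_sq using L
    by (simp add: l2_inner_bilinear L2_closed l2_inner_commute[of \<Omega> v w] l2_inner_commute[of \<Omega> v u] algebra_simps)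
  then show "(l2_norm \<Omega> w)\<^sup>2 + (l2_norm \<Omega> (\<lambda>x. 2 *\<^sub>R w x - v x))\<^sup>2
      - (l2_norm \<Omega> u)\<^sup>2 - (l2_norm \<Omega> (\<lambda>x. 2 *\<^sub>R u x - v x))\<^sup>2
      = 10 * \<nu>\<^sub>T * \<Delta>t * (l2_norm \<Omega> Z)\<^sup>2 - 4 * l2_inner \<Omega> (\<lambda>x. w x - u x) v"
    using e by simp
qed

text \<open>Expansion of the squared norm of \<open>4 f - g\<close>. Multiplied by 4, the weight 2
  uses up 8 of the 10 units of dissipation from step 2 and leaves the 2 units kept in the stability
  bound.\<close>

lemma l2_inner_young:
  assumes "f \<in> L2 \<Omega>" "g \<in> L2 \<Omega>"
  shows "l2_inner \<Omega> f g \<le> 2 * l2_inner \<Omega> f f + (1/8) * l2_inner \<Omega> g g"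
proof -
  have "0 \<le> l2_inner \<Omega> (\<lambda>x. 4 *\<^sub>R f x - g x) (\<lambda>x. 4 *\<^sub>R f x - g x)" by (rule l2_inner_self_nonneg)
  then show ?thesis using assms
    by (simp add: l2_inner_bilinear L2_closed l2_inner_commute[of \<Omega> g f])
qed

text \<open>Serves the step from time level 1 to 2, where the remaining gradient is that of the
  starting value \<open>u 1\<close>.\<close>

lemma bdf2_step2_inner_le_grad:
  assumes step: "bdf2_step2 \<Omega> r R \<psi> \<nu>\<^sub>T \<Delta>t w u" and pos: "\<Delta>t > 0" "\<nu>\<^sub>T > 0"
    and \<psi>: "\<And>i. i \<in> {1..R} \<Longrightarrow> \<psi> i \<in> X_space \<Omega>"
    and X: "Xr r \<psi> \<subseteq> X_space \<Omega>" and Xr: "w \<in> Xr r \<psi>" "u \<in> Xr r \<psi>" "v \<in> Xr r \<psi>"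
  defines "Z \<equiv> fluct_grad \<Omega> R \<psi> (\<lambda>x. (1/2) *\<^sub>R (w x + u x))"
  shows "l2_inner \<Omega> (\<lambda>x. w x - u x) v
    \<le> \<nu>\<^sub>T * \<Delta>t * (2 * (l2_norm \<Omega> Z)\<^sup>2 + (1/8) * (l2_norm \<Omega> (grad \<Omega> v))\<^sup>2)"
proof -
  have ZL: "Z \<in> L2 \<Omega>"
    unfolding Z_def using X Xr_midpoint[OF Xr(1,2)] by (intro fluct_grad_bound \<psi>) auto
  have v: "fluct_grad \<Omega> R \<psi> v \<in> L2 \<Omega>"
      "l2_inner \<Omega> (fluct_grad \<Omega> R \<psi> v) (fluct_grad \<Omega> R \<psi> v) \<le> l2_inner \<Omega> (grad \<Omega> v) (grad \<Omega> v)"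
    using X Xr by (auto intro!: fluct_grad_bound \<psi>)
  have "l2_inner \<Omega> Z (fluct_grad \<Omega> R \<psi> v)
      \<le> 2 * (l2_norm \<Omega> Z)\<^sup>2 + (1/8) * (l2_norm \<Omega> (grad \<Omega> v))\<^sup>2"
    using l2_inner_young[OF ZL v(1)] v(2) by (simp add: l2_norm_sq)
  then show ?thesis
    using bdf2_step2_test[OF step pos(1) Xr(3)] pos by (simp add: Z_def mult_left_mono)
qed

text \<open>Serves all later steps: \<open>v\<close> is itself an output of step 2, so its
  fluctuation is rewritten through quantities already controlled one time level earlier.\<close>

lemma bdf2_step2_inner_le_previous:
  assumes step: "bdf2_step2 \<Omega> r R \<psi> \<nu>\<^sub>T \<Delta>t w u" and pos: "\<Delta>t > 0" "\<nu>\<^sub>T > 0"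
    and step': "bdf2_step2 \<Omega> r R \<psi> \<nu>\<^sub>T \<Delta>t w' v"
    and \<psi>: "\<And>i. i \<in> {1..R} \<Longrightarrow> \<psi> i \<in> X_space \<Omega>"
    and X: "Xr r \<psi> \<subseteq> X_space \<Omega>" and Xr: "w \<in> Xr r \<psi>" "u \<in> Xr r \<psi>" "w' \<in> Xr r \<psi>" "v \<in> Xr r \<psi>"
  defines "Z \<equiv> fluct_grad \<Omega> R \<psi> (\<lambda>x. (1/2) *\<^sub>R (w x + u x))"
    and "Z' \<equiv> fluct_grad \<Omega> R \<psi> (\<lambda>x. (1/2) *\<^sub>R (w' x + v x))"
  shows "l2_inner \<Omega> (\<lambda>x. w x - u x) v
    \<le> \<nu>\<^sub>T * \<Delta>t * (2 * (l2_norm \<Omega> Z)\<^sup>2 + (1/2) * (l2_norm \<Omega> Z')\<^sup>2 + (1/8) * (l2_norm \<Omega> (grad \<Omega> w'))\<^sup>2)"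
proof -
  note L = subsetD[OF X, THEN X_space_L2]
  note fL = fluct_grad_bound(1)[OF \<psi> subsetD[OF X]]
  have ZL: "Z \<in> L2 \<Omega>" "Z' \<in> L2 \<Omega>"
    unfolding Z_def Z'_def by (intro fL Xr_midpoint Xr; assumption)+
  define W where "W = fluct_grad \<Omega> R \<psi> w'"
  have W: "W \<in> L2 \<Omega>" "l2_inner \<Omega> W W \<le> (l2_norm \<Omega> (grad \<Omega> w'))\<^sup>2"
    unfolding W_def l2_norm_sq using X Xr by (auto intro!: fluct_grad_bound \<psi>)
  have wv: "l2_inner \<Omega> (\<lambda>x. w' x - v x) w' = \<nu>\<^sub>T * \<Delta>t * l2_inner \<Omega> Z' W"
    unfolding Z'_def W_def by (rule bdf2_step2_test[OF step' pos(1) Xr(3)])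
  have "(l2_norm \<Omega> w')\<^sup>2 - (l2_norm \<Omega> v)\<^sup>2 = 2 * \<nu>\<^sub>T * \<Delta>t * (l2_norm \<Omega> Z')\<^sup>2"
    unfolding Z'_def by (rule bdf2_step2_energy(1)[OF step' pos(1) Xr(3,4) Xr(4) L[OF Xr(3)] L[OF Xr(4)] L[OF Xr(4)]])
  also have "\<dots> \<ge> 0" using pos by simp
  finally have "l2_inner \<Omega> v v \<le> l2_inner \<Omega> w' w'" by (simp add: l2_norm_sq)
  \<comment> \<open>By polarization, \<open>(w' - v, w')\<close> is half of the sum of the norm drop
    from \<open>w'\<close> to \<open>v\<close> and this square.\<close>
  moreover have "0 \<le> l2_inner \<Omega> (\<lambda>x. w' x - v x) (\<lambda>x. w' x - v x)" by (rule l2_inner_self_nonneg)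
  ultimately have "0 \<le> l2_inner \<Omega> (\<lambda>x. w' x - v x) w'"
    using L[OF Xr(3)] L[OF Xr(4)] by (simp add: l2_inner_bilinear L2_closed l2_inner_commute[of \<Omega> v w'])
  then have cross: "0 \<le> l2_inner \<Omega> Z' W"
    using wv mult_pos_pos[OF pos(2,1)] by (simp add: zero_le_mult_iff)
  \<comment> \<open>\<open>v\<close> is twice the midpoint minus \<open>w'\<close>. Testing with
    these two functions separately expresses the fluctuation of \<open>v\<close> by
    \<open>Z'\<close> and \<open>W\<close>.\<close>
  have "l2_inner \<Omega> (\<lambda>x. w x - u x) v
      = 2 * l2_inner \<Omega> (\<lambda>x. w x - u x) (\<lambda>x. (1/2) *\<^sub>R (w' x + v x)) - l2_inner \<Omega> (\<lambda>x. w x - u x) w'"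
    using L[OF Xr(1)] L[OF Xr(2)] L[OF Xr(3)] L[OF Xr(4)]
    by (simp add: l2_inner_scale_right l2_inner_bilinear L2_closed add_divide_distrib diff_divide_distrib)
  also have "\<dots> = \<nu>\<^sub>T * \<Delta>t * (2 * l2_inner \<Omega> Z Z' - l2_inner \<Omega> Z W)"
    using bdf2_step2_test[OF step pos(1) Xr_midpoint[OF Xr(3,4)]] bdf2_step2_test[OF step pos(1) Xr(3)]
    by (simp add: Z_def Z'_def W_def algebra_simps)
  also have "2 * l2_inner \<Omega> Z Z' - l2_inner \<Omega> Z W = l2_inner \<Omega> Z (\<lambda>x. 2 *\<^sub>R Z' x - W x)"
    using ZL W by (simp add: l2_inner_bilinear L2_closed)
  also have "\<nu>\<^sub>T * \<Delta>t * \<dots> \<le> \<nu>\<^sub>T * \<Delta>t * (2 * (l2_norm \<Omega> Z)\<^sup>2 + (1/2) * (l2_norm \<Omega> Z')\<^sup>2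
      + (1/8) * (l2_norm \<Omega> (grad \<Omega> w'))\<^sup>2)"
  proof (rule mult_left_mono)
    \<comment> \<open>Here \<open>c\<close> is the cross term of \<open>Z'\<close> and
      \<open>W\<close>, dropped by its sign, and \<open>m\<close> is the fluctuation part replaced
      by the full gradient.\<close>
    have arith: "x \<le> 2 * z + (1/8) * (4 * a - 4 * c + m) \<Longrightarrow> 0 \<le> c \<Longrightarrow> m \<le> g
        \<Longrightarrow> x \<le> 2 * z + (1/2) * a + (1/8) * g" for x z a c m g :: real
      by argo
    have "l2_inner \<Omega> Z (\<lambda>x. 2 *\<^sub>R Z' x - W x)
        \<le> 2 * l2_inner \<Omega> Z Z + (1/8) * l2_inner \<Omega> (\<lambda>x. 2 *\<^sub>R Z' x - W x) (\<lambda>x. 2 *\<^sub>R Z' x - W x)"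
      using ZL W by (intro l2_inner_young L2_closed)
    also have "l2_inner \<Omega> (\<lambda>x. 2 *\<^sub>R Z' x - W x) (\<lambda>x. 2 *\<^sub>R Z' x - W x)
        = 4 * l2_inner \<Omega> Z' Z' - 4 * l2_inner \<Omega> Z' W + l2_inner \<Omega> W W"
      using ZL W by (simp add: l2_inner_bilinear L2_closed l2_inner_commute[of \<Omega> W Z'])
    finally show "l2_inner \<Omega> Z (\<lambda>x. 2 *\<^sub>R Z' x - W x)
        \<le> 2 * (l2_norm \<Omega> Z)\<^sup>2 + (1/2) * (l2_norm \<Omega> Z')\<^sup>2 + (1/8) * (l2_norm \<Omega> (grad \<Omega> w'))\<^sup>2"
      using cross W(2) unfolding l2_norm_sq[of \<Omega> Z] l2_norm_sq[of \<Omega> Z'] by (rule arith)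
  qed (use pos in simp)
  finally show ?thesis .
qed

section \<open>Summation over the time steps\<close>

text \<open>\<open>a\<close> and \<open>q * Q\<close> telescope. Each \<open>p * G\<close> meets
  \<open>(p - t) * G\<close> of the next step and leaves \<open>t * G\<close>, except at the last
  level, where \<open>p * G\<close> survives whole; hence the sum of \<open>G\<close> stops at
  \<open>M - 1\<close>.\<close>

lemma telescoped_energy:
  fixes a D G Q N :: "int \<Rightarrow> real"
  assumes "1 \<le> M"
    and first: "a 2 + D 1 + p * G 2 + q * Q 2 \<le> a 1 + c + s * N 2"
    and later: "\<And>n. 2 \<le> n \<Longrightarrow> n \<le> M \<Longrightarrow>
      a (n + 1) + D n + p * G (n + 1) + q * Q (n + 1) \<le> a n + q * Q n + (p - t) * G n + s * N (n + 1)"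
  shows "a (M + 1) + q * Q (M + 1) + p * G (M + 1) + (\<Sum>n=1..M. D n) + t * (\<Sum>n=1..M-1. G (n + 1))
    \<le> a 1 + c + s * (\<Sum>n=1..M. N (n + 1))"
  using assms(1) later
proof (induction M rule: int_ge_induct)
  case base
  then show ?case using first by simp
next
  case (step m)
  have IH: "a (m + 1) + q * Q (m + 1) + p * G (m + 1) + (\<Sum>n=1..m. D n) + t * (\<Sum>n=1..m-1. G (n + 1))
      \<le> a 1 + c + s * (\<Sum>n=1..m. N (n + 1))"
    by (rule step.IH) (rule step.prems; simp)
  have "a (m + 1 + 1) + D (m + 1) + p * G (m + 1 + 1) + q * Q (m + 1 + 1)
      \<le> a (m + 1) + q * Q (m + 1) + (p - t) * G (m + 1) + s * N (m + 1 + 1)"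
    using step.hyps by (intro step.prems) auto
  \<comment> \<open>The intervals are integer ones; splitting off the top index of the
    \<open>G\<close> sum gives \<open>G (m + 1)\<close>, exactly the term released by the new
    step.\<close>
  moreover have "{1..m + 1} = insert (m + 1) {1..m}" "{1..m + 1 - 1} = insert m {1..m - 1}"
    using step.hyps by auto
  then have "(\<Sum>n=1..m+1. D n) = D (m + 1) + (\<Sum>n=1..m. D n)"
      "(\<Sum>n=1..m+1-1. G (n + 1)) = G (m + 1) + (\<Sum>n=1..m-1. G (n + 1))"
      "(\<Sum>n=1..m+1. N (n + 1)) = N (m + 1 + 1) + (\<Sum>n=1..m. N (n + 1))"
    by simp_all
  ultimately show ?case
    using IH by (simp only: distrib_left left_diff_distrib)
qed

theorem lemma3p2:
  fixes \<Omega> :: "(real ^ 'n) set"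
    and \<psi> :: "nat \<Rightarrow> 'n vfield"
    and r R :: nat
    and \<nu> \<nu>\<^sub>T \<Delta>t T :: real
    and f :: "real \<Rightarrow> 'n vfield \<Rightarrow> real"
    and u w :: "int \<Rightarrow> 'n vfield"
    and M :: int
  assumes "CARD('n) \<in> {2, 3}"
    and "polyhedral_domain \<Omega>"
    and "\<nu> > 0" and "\<nu>\<^sub>T > 0" and "\<Delta>t > 0"
    and "M \<ge> 1" and "of_int (M + 1) * \<Delta>t \<le> T"
    and "f \<in> L2_time_Hm1 T \<Omega>"
    and "\<forall>i\<in>{1..r}. \<psi> i \<in> X_space \<Omega>"
    and "orthonormal_fields \<Omega> r \<psi>"
    and "R < r"
    and "u (-1) \<in> Xr r \<psi>" and "u 0 \<in> Xr r \<psi>"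
    and "\<forall>n\<in>{0..M}. bdf2_step1 \<Omega> r \<psi> \<nu> \<Delta>t (f (of_int (n + 1) * \<Delta>t)) (u (n - 1)) (u n) (w (n + 1))"
    and "\<forall>n\<in>{0..M}. bdf2_step2 \<Omega> r R \<psi> \<nu>\<^sub>T \<Delta>t (w (n + 1)) (u (n + 1))"
    and "\<nu>\<^sub>T < 4 * \<nu>"
  shows "(l2_norm \<Omega> (u (M + 1)))\<^sup>2
       + (l2_norm \<Omega> (\<lambda>x. 2 *\<^sub>R u (M + 1) x - u M x))\<^sup>2
       + 2 * \<nu>\<^sub>T * \<Delta>t
           * (l2_norm \<Omega> (fluct_grad \<Omega> R \<psi> (\<lambda>x. (1/2) *\<^sub>R (w (M + 1) x + u (M + 1) x))))\<^sup>2
       + 2 * \<nu> * \<Delta>t * (l2_norm \<Omega> (grad \<Omega> (w (M + 1))))\<^sup>2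
       + (\<Sum>n=1..M. (l2_norm \<Omega> (\<lambda>x. w (n + 1) x - 2 *\<^sub>R u n x + u (n - 1) x))\<^sup>2)
       + (4 * \<nu> - \<nu>\<^sub>T) * (\<Delta>t / 2) * (\<Sum>n=1..M-1. (l2_norm \<Omega> (grad \<Omega> (w (n + 1))))\<^sup>2)
     \<le> (l2_norm \<Omega> (u 1))\<^sup>2
       + (l2_norm \<Omega> (\<lambda>x. 2 *\<^sub>R u 1 x - u 0 x))\<^sup>2
       + \<nu>\<^sub>T * \<Delta>t / 2 * (l2_norm \<Omega> (grad \<Omega> (u 1)))\<^sup>2
       + 2 * inverse \<nu> * (norm_2_m1 \<Omega> \<Delta>t M f)\<^sup>2"
proof -
  have \<Omega>: "open \<Omega>" "bounded \<Omega>"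
    using assms(2) by (auto simp: polyhedral_domain_def)
  note pos = assms(3-5)
  have X: "Xr r \<psi> \<subseteq> X_space \<Omega>"
    using X_space_span[OF \<Omega>, of r \<psi>] assms(9) by (auto simp: Xr_eq_field_span)
  have \<psi>: "\<psi> i \<in> X_space \<Omega>" if "i \<in> {1..R}" for i
    using that assms(9,11) by auto
  have s1: "bdf2_step1 \<Omega> r \<psi> \<nu> \<Delta>t (f (of_int (n + 1) * \<Delta>t)) (u (n - 1)) (u n) (w (n + 1))"
    and s2: "bdf2_step2 \<Omega> r R \<psi> \<nu>\<^sub>T \<Delta>t (w (n + 1)) (u (n + 1))" if "0 \<le> n" "n \<le> M" for n
    using assms(14,15) that by auto
  have wX: "w n \<in> Xr r \<psi>" if "1 \<le> n" "n \<le> M + 1" for n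
    using s1[of "n - 1"] that by (simp add: bdf2_step1_def)
  have uX: "u n \<in> Xr r \<psi>" if "0 \<le> n" "n \<le> M + 1" for n
    using s2[of "n - 1"] that assms(13) by (cases "n = 0") (auto simp: bdf2_step2_def)
  have f: "f (of_int n * \<Delta>t) \<in> Hm1 \<Omega>" if "0 \<le> n" "n \<le> M + 1" for n
  proof -
    have "of_int n * \<Delta>t \<le> of_int (M + 1) * \<Delta>t"
      using that pos by (intro mult_right_mono) auto
    then have "of_int n * \<Delta>t \<le> T" using assms(7) by (rule order_trans)
    then have "of_int n * \<Delta>t \<in> {0..T}" using that pos by simp
    then show ?thesis using assms(8) by (simp add: L2_time_Hm1_def)
  qed
  define a where "a n = (l2_norm \<Omega> (u n))\<^sup>2 + (l2_norm \<Omega> (\<lambda>x. 2 *\<^sub>R u n x - u (n - 1) x))\<^sup>2" for n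
  define D where "D n = (l2_norm \<Omega> (\<lambda>x. w (n + 1) x - 2 *\<^sub>R u n x + u (n - 1) x))\<^sup>2" for n
  define G where "G n = (l2_norm \<Omega> (grad \<Omega> (w n)))\<^sup>2" for n
  define Q where "Q n = (l2_norm \<Omega> (fluct_grad \<Omega> R \<psi> (\<lambda>x. (1/2) *\<^sub>R (w n x + u n x))))\<^sup>2" for n
  define N where "N n = (Hm1_norm \<Omega> (f (of_int n * \<Delta>t)))\<^sup>2" for n
  define c where "c = \<nu>\<^sub>T * \<Delta>t / 2 * (l2_norm \<Omega> (grad \<Omega> (u 1)))\<^sup>2"
  \<comment> \<open>Steps 1 and 2 combined, with \<open>w (n + 1)\<close> replaced by
    \<open>u (n + 1)\<close> in the energy. Only the inner product with \<open>u n\<close> still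
    lacks a sign.\<close>
  have energy: "a (n + 1) + D n + 2 * \<nu> * \<Delta>t * G (n + 1) + 10 * \<nu>\<^sub>T * \<Delta>t * Q (n + 1)
      \<le> a n + 4 * l2_inner \<Omega> (\<lambda>x. w (n + 1) x - u (n + 1) x) (u n) + 2 * inverse \<nu> * \<Delta>t * N (n + 1)"
    if n: "1 \<le> n" "n \<le> M" for n
  proof -
    have Xr: "w (n + 1) \<in> Xr r \<psi>" "u (n + 1) \<in> Xr r \<psi>" "u n \<in> Xr r \<psi>" "u (n - 1) \<in> Xr r \<psi>"
      using wX uX n by auto
    note XX = Xr[THEN subsetD[OF X]]
    note L = XX[THEN X_space_L2]
    have "a n + 2 * inverse \<nu> * \<Delta>t * N (n + 1) \<ge>
        (l2_norm \<Omega> (w (n + 1)))\<^sup>2 + (l2_norm \<Omega> (\<lambda>x. 2 *\<^sub>R w (n + 1) x - u n x))\<^sup>2 + D n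
          + 2 * \<nu> * \<Delta>t * G (n + 1)"
      unfolding a_def D_def G_def N_def
      using n by (intro bdf2_step1_energy[OF s1 XX(4,3,1) pos(1,3) f]) auto
    moreover have "(l2_norm \<Omega> (w (n + 1)))\<^sup>2 + (l2_norm \<Omega> (\<lambda>x. 2 *\<^sub>R w (n + 1) x - u n x))\<^sup>2 - a (n + 1)
        = 10 * \<nu>\<^sub>T * \<Delta>t * Q (n + 1) - 4 * l2_inner \<Omega> (\<lambda>x. w (n + 1) x - u (n + 1) x) (u n)"
      using bdf2_step2_energy(2)[OF s2 pos(3) Xr(1-3) L(1-3)] n by (simp add: a_def Q_def)
    ultimately show ?thesis by linarith
  qed
  have "a (M + 1) + 2 * \<nu>\<^sub>T * \<Delta>t * Q (M + 1) + 2 * \<nu> * \<Delta>t * G (M + 1) + (\<Sum>n=1..M. D n)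
      + (4 * \<nu> - \<nu>\<^sub>T) * (\<Delta>t / 2) * (\<Sum>n=1..M-1. G (n + 1))
      \<le> a 1 + c + 2 * inverse \<nu> * \<Delta>t * (\<Sum>n=1..M. N (n + 1))"
  \<comment> \<open>Here \<open>p = 2 * \<nu> * \<Delta>t\<close>,
    \<open>q = 2 * \<nu>\<^sub>T * \<Delta>t\<close>,
    \<open>t = (4 * \<nu> - \<nu>\<^sub>T) * (\<Delta>t / 2)\<close> and
    \<open>s = 2 * inverse \<nu> * \<Delta>t\<close>.\<close>
  proof (rule telescoped_energy[OF assms(6)])
    have "l2_inner \<Omega> (\<lambda>x. w 2 x - u 2 x) (u 1)
        \<le> \<nu>\<^sub>T * \<Delta>t * (2 * Q 2 + (1/8) * (l2_norm \<Omega> (grad \<Omega> (u 1)))\<^sup>2)"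
      unfolding Q_def using s2[of 1] assms(6)
      by (intro bdf2_step2_inner_le_grad[OF _ pos(3,2) \<psi> X] wX uX) auto
    also have "\<dots> = 2 * \<nu>\<^sub>T * \<Delta>t * Q 2 + c / 4"
      by (simp add: c_def algebra_simps)
    finally show "a 2 + D 1 + 2 * \<nu> * \<Delta>t * G 2 + 2 * \<nu>\<^sub>T * \<Delta>t * Q 2
        \<le> a 1 + c + 2 * inverse \<nu> * \<Delta>t * N 2"
      using energy[of 1] assms(6) by simp
    fix n assume n: "2 \<le> n" "n \<le> M"
    have "l2_inner \<Omega> (\<lambda>x. w (n + 1) x - u (n + 1) x) (u n)
        \<le> \<nu>\<^sub>T * \<Delta>t * (2 * Q (n + 1) + (1/2) * Q n + (1/8) * G n)"
      unfolding Q_def G_def using s2[of n] s2[of "n - 1"] n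
      by (intro bdf2_step2_inner_le_previous[OF _ pos(3,2) _ \<psi> X] wX uX) auto
    \<comment> \<open>The coefficient \<open>p - t\<close> of \<open>G n\<close> equals
      \<open>\<nu>\<^sub>T * \<Delta>t / 2\<close>, four times the weight 1/8 from Young's
      inequality.\<close>
    then show "a (n + 1) + D n + 2 * \<nu> * \<Delta>t * G (n + 1) + 2 * \<nu>\<^sub>T * \<Delta>t * Q (n + 1)
        \<le> a n + 2 * \<nu>\<^sub>T * \<Delta>t * Q n + (2 * \<nu> * \<Delta>t - (4 * \<nu> - \<nu>\<^sub>T) * (\<Delta>t / 2)) * G n
          + 2 * inverse \<nu> * \<Delta>t * N (n + 1)"
      using energy[of n] n by (simp add: algebra_simps)
  qed
  also have "(\<Sum>n=1..M. N (n + 1)) = (\<Sum>n=2..M+1. N n)"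
    by (rule sum.reindex_bij_witness[of _ "\<lambda>n. n - 1" "\<lambda>n. n + 1"]) auto
  \<comment> \<open>The forcing enters only at the levels 2 to \<open>M + 1\<close>; the nonnegative
    terms at levels 0 and 1 are added to reach the full norm.\<close>
  also have "2 * inverse \<nu> * \<Delta>t * (\<Sum>n=2..M+1. N n) \<le> 2 * inverse \<nu> * (norm_2_m1 \<Omega> \<Delta>t M f)\<^sup>2"
  proof -
    have "(\<Sum>n=2..M+1. N n) \<le> (\<Sum>n=0..M+1. N n)"
      by (rule sum_mono2) (auto simp: N_def)
    moreover have "(norm_2_m1 \<Omega> \<Delta>t M f)\<^sup>2 = \<Delta>t * (\<Sum>n=0..M+1. N n)"
      unfolding norm_2_m1_def N_def using pos
      by (intro real_sqrt_pow2 mult_nonneg_nonneg sum_nonneg) auto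
    ultimately show ?thesis
      using pos by (simp add: mult.assoc mult_left_mono)
  qed
  finally show ?thesis
    by (simp add: a_def D_def G_def Q_def c_def algebra_simps)
qed

end
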